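(* Let $d\in\mathbb{N}$ be a spatial dimension, $c,c'\in\mathbb{N}$ channel sizes, and $\sigma:\mathbb{R}\to\mathbb{R}$ a non-polynomial continuous activation function. Define $$N_d=\begin{cases}2 & \text{if } d=1,2,\\ 3 & \text{if } d=3,\\ d-1 & \text{if } d\ge 4.\end{cases}$$ Then $N_d$ is the minimum depth required for three-kernel CNNs to have the universal approximation property, in the following sense: for every compact set $K\subset\mathbb{R}^{c\times d}$, $$\overline{\Sigma^{\sigma,d,3}_{N_d,c,c'}}=C(K,\mathbb{R}^{c'\times d}),$$ and there exists a compact set $K\subset\mathbb{R}^{c\times d}$ such that $$\overline{\Sigma^{\sigma,d,3}_{N_d-1,c,c'}}\nsupseteq C(K,\mathbb{R}^{c'\times d}).$$
   Context: $\mathbb{N}=\{1,2,\dots\}$, and $C(X,Y)$ is the set of continuous functions from $X$ to $Y$. An element $x\in\mathbb{R}^{c\times d}$ is written $x=(x^1,\dots,x^c)$ with channels $x^i=(x^i_1,\dots,x^i_d)\in\mathbb{R}^d$. $\boldsymbol{1}_d\in\mathbb{R}^d$ is the all-ones vector. Zero-padding convolution: for a kernel $w=(w_{-k},\dots,w_k)\in\mathbb{R}^{2k+1}$ (kernel size $2k+1$) and $x\in\mathbb{R}^d$, $w\circledast x\in\mathbb{R}^d$ is given by $(w\circledast x)_i=\sum_{j=-k}^{k}w_jx_{i-j}$ for $1\le i\le d$, with the convention $x_m=0$ for $m\notin\{1,\dots,d\}$. Convolutional layers: $\mathcal{L}^{d,2k+1}_{c_1,c_2}$ is the set of maps $f=(f^1,\dots,f^{c_2}):\mathbb{R}^{c_1\times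 d}\to\mathbb{R}^{c_2\times d}$ of the form $f^i(x)=\sum_{j=1}^{c_1}w_{i,j}\circledast x^j+\delta_i\boldsymbol{1}_d$ with $w_{i,j}\in\mathbb{R}^{2k+1}$, $\delta_i\in\mathbb{R}$. CNNs: the activation $\sigma$ is applied componentwise. $\Sigma^{\sigma,d,2k+1}_{N,c,c'}$ is the set of all functions $C_N\circ\sigma\circ C_{N-1}\circ\cdots\circ\sigma\circ C_1:\mathbb{R}^{c\times d}\to\mathbb{R}^{c'\times d}$ with $C_i\in\mathcal{L}^{d,2k+1}_{c_{i-1},c_i}$, $c_0=c$, $c_N=c'$ and arbitrary $c_1,\dots,c_{N-1}\in\mathbb{N}$. For a compact $K\subset\mathbb{R}^{c\times d}$, its elements are regarded as elements of $C(K,\mathbb{R}^{c'\times d})$ by restriction, and the overline denotes closure in $C(K,\mathbb{R}^{c'\times d})$ with respect to the uniform norm $\|f\|_{\infty,K}=\sup_{x\in K}\|f(x)\|_\infty$. *)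

theory Defs
  imports "HOL-Analysis.Analysis" "HOL-Computational_Algebra.Polynomial"
begin

text \<open>An element of \<open>\<real>\<^sup>c\<^sup>\<times>\<^sup>d\<close> is a function \<open>x\<close> with \<open>x i m\<close> the entry at channel \<open>i \<in> {1..c}\<close> and
  position \<open>m \<in> {1..d}\<close>, and with value 0 at all other indices. Positions are integers, so that the
  convention \<open>x\<^sub>m = 0\<close> for \<open>m \<notin> {1..d}\<close> of the zero-padding convolution is built in.\<close>

type_synonym tensor = "nat \<Rightarrow> int \<Rightarrow> real"

definition tensors :: "nat \<Rightarrow> nat \<Rightarrow> tensor set" where
  "tensors c d = {x. \<forall>i m. i \<notin> {1..c} \<or> m \<notin> {1..int d} \<longrightarrow> x i m = 0}"

definition mk_tensor :: "nat \<Rightarrow> nat \<Rightarrow> (nat \<Rightarrow> int \<Rightarrow> real) \<Rightarrow> tensor" where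
  "mk_tensor c d f = (\<lambda>i m. if i \<in> {1..c} \<and> m \<in> {1..int d} then f i m else 0)"

text \<open>The distance induced by the maximum norm; inserting 0 only matters if \<open>c = 0\<close> or \<open>d = 0\<close>.\<close>

definition tensor_dist :: "nat \<Rightarrow> nat \<Rightarrow> tensor \<Rightarrow> tensor \<Rightarrow> real" where
  "tensor_dist c d x y =
     Max (insert 0 ((\<lambda>(i, m). \<bar>x i m - y i m\<bar>) ` ({1..c} \<times> {1..int d})))"

definition tensor_metric :: "nat \<Rightarrow> nat \<Rightarrow> tensor metric" where
  "tensor_metric c d = metric (tensors c d, tensor_dist c d)"

lemma tensor_dist_le_iff:
  "tensor_dist c d x y \<le> e \<longleftrightarrow>
     0 \<le> e \<and> (\<forall>i\<in>{1..c}. \<forall>m\<in>{1..int d}. \<bar>x i m - y i m\<bar> \<le> e)"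
  unfolding tensor_dist_def by (subst Max_le_iff) auto

lemma Metric_space_tensor_dist: "Metric_space (tensors c d) (tensor_dist c d)"
proof
  fix x y :: tensor
  show "0 \<le> tensor_dist c d x y"
    unfolding tensor_dist_def by (intro Max_ge) auto
  show "tensor_dist c d x y = tensor_dist c d y x"
    unfolding tensor_dist_def by (simp add: abs_minus_commute)
next
  fix x y assume xy: "x \<in> tensors c d" "y \<in> tensors c d"
  show "tensor_dist c d x y = 0 \<longleftrightarrow> x = y"
  proof
    assume "tensor_dist c d x y = 0"
    then have *: "\<forall>i\<in>{1..c}. \<forall>m\<in>{1..int d}. \<bar>x i m - y i m\<bar> \<le> 0"
      using tensor_dist_le_iff[of c d x y 0] by simp
    show "x = y"
    proof (intro ext)
      fix i m
      show "x i m = y i m"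
      proof (cases "i \<in> {1..c} \<and> m \<in> {1..int d}")
        case True
        then show ?thesis using * by fastforce
      next
        case False
        then have "x i m = 0" "y i m = 0"
          using xy unfolding tensors_def by blast+
        then show ?thesis by simp
      qed
    qed
  next
    assume "x = y"
    then have "tensor_dist c d x y \<le> 0" by (simp add: tensor_dist_le_iff)
    moreover have "0 \<le> tensor_dist c d x y"
      unfolding tensor_dist_def by (intro Max_ge) auto
    ultimately show "tensor_dist c d x y = 0" by simp
  qed
next
  fix x y z
  have nonneg: "0 \<le> tensor_dist c d u v" for u v
    unfolding tensor_dist_def by (intro Max_ge) auto
  have le: "\<bar>u i m - v i m\<bar> \<le> tensor_dist c d u v"
    if "i \<in> {1..c}" "m \<in> {1..int d}" for u v i m
    using tensor_dist_le_iff[of c d u v "tensor_dist c d u v"] that by simp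
  show "tensor_dist c d x z \<le> tensor_dist c d x y + tensor_dist c d y z"
    unfolding tensor_dist_le_iff[of c d x z]
  proof (intro conjI ballI)
    fix i m assume im: "i \<in> {1..c}" "m \<in> {1..int d}"
    show "\<bar>x i m - z i m\<bar> \<le> tensor_dist c d x y + tensor_dist c d y z"
      using le[OF im, of x y] le[OF im, of y z] by linarith
  qed (simp add: nonneg)
qed

lemma mspace_tensor_metric [simp]: "mspace (tensor_metric c d) = tensors c d"
  by (simp add: tensor_metric_def Metric_space.mspace_metric[OF Metric_space_tensor_dist])

lemma mdist_tensor_metric [simp]: "mdist (tensor_metric c d) = tensor_dist c d"
  by (simp add: tensor_metric_def Metric_space.mdist_metric[OF Metric_space_tensor_dist])

text \<open>\<open>C(K, \<real>\<^sup>c\<^sup>'\<^sup>\<times>\<^sup>d)\<close> with the uniform distance. The boundedness built into \<^const>\<open>cfunspace\<close> is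
  automatic for compact \<open>K\<close>.\<close>

definition C_metric :: "nat \<Rightarrow> nat \<Rightarrow> nat \<Rightarrow> tensor set \<Rightarrow> (tensor \<Rightarrow> tensor) metric" where
  "C_metric c c' d K =
     cfunspace (subtopology (mtopology_of (tensor_metric c d)) K) (tensor_metric c' d)"

lemma mspace_C_metric:
  assumes "compactin (mtopology_of (tensor_metric c d)) K"
  shows "mspace (C_metric c c' d K) =
    {f \<in> extensional K. continuous_map (subtopology (mtopology_of (tensor_metric c d)) K)
       (mtopology_of (tensor_metric c' d)) f}"
proof -
  let ?X = "subtopology (mtopology_of (tensor_metric c d)) K"
  have top: "topspace ?X = K"
    using compactin_subset_topspace[OF assms] by auto
  have "Metric_space.mbounded (tensors c' d) (tensor_dist c' d) (f ` K)"
    if "continuous_map ?X (mtopology_of (tensor_metric c' d)) f" for f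
  proof -
    have "compactin ?X K"
      using assms by (simp add: compactin_subtopology)
    then have "compactin (mtopology_of (tensor_metric c' d)) (f ` K)"
      using that image_compactin by blast
    then show ?thesis
      using Metric_space.compactin_imp_mbounded[OF Metric_space_tensor_dist]
      by (simp add: mtopology_of_def)
  qed
  moreover have "f \<in> K \<rightarrow> tensors c' d"
    if "continuous_map ?X (mtopology_of (tensor_metric c' d)) f" for f
    using continuous_map_funspace[OF that] unfolding top by simp
  ultimately show ?thesis
    unfolding C_metric_def mspace_cfunspace top by auto
qed

text \<open>A kernel of size \<open>2k+1\<close> is a function on the integers of which only the values on \<open>{-k..k}\<close>
  are used.\<close>

definition conv :: "nat \<Rightarrow> (int \<Rightarrow> real) \<Rightarrow> (int \<Rightarrow> real) \<Rightarrow> (int \<Rightarrow> real)" where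
  "conv k w x = (\<lambda>m. \<Sum>j = - int k..int k. w j * x (m - j))"

text \<open>The sets of layers and of networks below carry the half width \<open>k\<close> in place of the kernel size
  \<open>2k+1\<close>. Their members are meant as maps on \<^const>\<open>tensors\<close>.\<close>

definition conv_layers :: "nat \<Rightarrow> nat \<Rightarrow> nat \<Rightarrow> nat \<Rightarrow> (tensor \<Rightarrow> tensor) set" where
  "conv_layers d k c1 c2 =
     {f. \<exists>(w :: nat \<Rightarrow> nat \<Rightarrow> int \<Rightarrow> real) (\<delta> :: nat \<Rightarrow> real).
        f = (\<lambda>x. mk_tensor c2 d (\<lambda>i m. (\<Sum>j = 1..c1. conv k (w i j) (x j) m) + \<delta> i))}"

definition activation :: "(real \<Rightarrow> real) \<Rightarrow> nat \<Rightarrow> nat \<Rightarrow> tensor \<Rightarrow> tensor" where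
  "activation \<sigma> d c x = mk_tensor c d (\<lambda>i m. \<sigma> (x i m))"

text \<open>\<open>cnns \<sigma> d k N c c'\<close> is the set of all \<open>C\<^sub>N \<circ> \<sigma> \<circ> C\<^sub>N\<^sub>-\<^sub>1 \<circ> \<dots> \<circ> \<sigma> \<circ> C\<^sub>1\<close>; it is empty for \<open>N = 0\<close>.\<close>

fun cnns :: "(real \<Rightarrow> real) \<Rightarrow> nat \<Rightarrow> nat \<Rightarrow> nat \<Rightarrow> nat \<Rightarrow> nat \<Rightarrow> (tensor \<Rightarrow> tensor) set" where
  "cnns \<sigma> d k 0 c c' = {}"
| "cnns \<sigma> d k (Suc 0) c c' = conv_layers d k c c'"
| "cnns \<sigma> d k (Suc (Suc N)) c c' =
     {C \<circ> activation \<sigma> d e \<circ> g | C e g.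
        e \<ge> 1 \<and> C \<in> conv_layers d k e c' \<and> g \<in> cnns \<sigma> d k (Suc N) c e}"

definition cnn_closure ::
    "(real \<Rightarrow> real) \<Rightarrow> nat \<Rightarrow> nat \<Rightarrow> nat \<Rightarrow> nat \<Rightarrow> nat \<Rightarrow> tensor set \<Rightarrow> (tensor \<Rightarrow> tensor) set" where
  "cnn_closure \<sigma> d k N c c' K =
     mtopology_of (C_metric c c' d K) closure_of ((\<lambda>f. restrict f K) ` cnns \<sigma> d k N c c')"

definition uap_depth :: "nat \<Rightarrow> nat" where
  "uap_depth d = (if d \<le> 2 then 2 else if d = 3 then 3 else d - 1)"

end

theory Submission
  imports Defs
begin

text \<open>Upper bound. Taking \<open>k\<close>-fold differences of \<open>\<sigma>\<close> shows that the closed span of \<open>t \<mapsto> \<sigma> (a t + b)\<close>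
  contains every power of \<open>t\<close>, unless some order of differences of \<open>\<sigma>\<close> vanishes identically, which
  forces \<open>\<sigma>\<close> to be a polynomial. Hence a hidden channel may apply any continuous function, in
  particular \<open>exp\<close>, which turns sums into products. By Stone--Weierstrass the activations after \<open>n\<close>
  layers are dense in the continuous functions of (input, position) that depend only on what the
  position sees: the zero-padded window of radius \<open>n\<close> and the borders within distance \<open>n - 1\<close>. With
  \<open>n = N\<^sub>d - 1\<close> and \<open>2n > d\<close> the position itself is visible, and the last layer can move a function
  supported at one position to a neighbour. For \<open>d = 2\<close> and \<open>d = 4\<close> only the two middle
  positions can be confused, and the resulting unwanted terms are cancelled by hand.

  Lower bound. For \<open>d \<ge> 4\<close> the first output does not see the last input; for \<open>d \<le> 2\<close> one layer
  is affine; for \<open>d = 3\<close> weight sharing enforces a linear relation between the outputs at positions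
  2 and 3.\<close>

section \<open>Closed linear spans\<close>

text \<open>The closure of the linear span of \<open>B\<close> in the uniform norm on
  \<open>S\<close>. Having limits as a closure rule lets approximations be nested without tracking
  errors, and identifies functions that agree on \<open>S\<close>.\<close>

inductive_set uspan :: "'z set \<Rightarrow> ('z \<Rightarrow> real) set \<Rightarrow> ('z \<Rightarrow> real) set" for S B where
  base: "f \<in> B \<Longrightarrow> f \<in> uspan S B"
| zero: "(\<lambda>_. 0) \<in> uspan S B"
| add: "f \<in> uspan S B \<Longrightarrow> g \<in> uspan S B \<Longrightarrow> (\<lambda>z. f z + g z) \<in> uspan S B"
| scale: "f \<in> uspan S B \<Longrightarrow> (\<lambda>z. r * f z) \<in> uspan S B"
| lim: "(\<And>e. e > 0 \<Longrightarrow> \<exists>g. g \<in> uspan S B \<and> (\<forall>z\<in>S. \<bar>f z - g z\<bar> < e)) \<Longrightarrow> f \<in> uspan S B"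

lemma uspan_cong:
  assumes "g \<in> uspan S B" "\<And>z. z \<in> S \<Longrightarrow> f z = g z"
  shows "f \<in> uspan S B"
  by (rule uspan.lim) (use assms in auto)

lemma uspan_diff:
  assumes "f \<in> uspan S B" "g \<in> uspan S B"
  shows "(\<lambda>z. f z - g z) \<in> uspan S B"
  using uspan.add[OF assms(1) uspan.scale[OF assms(2), of "-1"]] by simp

lemma uspan_sum:
  assumes "\<And>i. i \<in> I \<Longrightarrow> f i \<in> uspan S B"
  shows "(\<lambda>z. \<Sum>i\<in>I. f i z) \<in> uspan S B"
  using assms by (induction I rule: infinite_finite_induct) (auto intro: uspan.intros)

text \<open>The operator taking \<open>f\<close> to
  \<open>\<lambda>z. \<phi> z * f (\<tau> z)\<close> is linear and does not increase uniform norms,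
  so it suffices to check generators. Where \<open>\<phi>\<close> vanishes, \<open>\<tau>\<close>
  may leave \<open>S\<close>; this accommodates zero padding.\<close>

lemma uspan_weighted_comp:
  assumes "f \<in> uspan S B"
    and bd: "\<And>z. z \<in> S' \<Longrightarrow> \<bar>\<phi> z\<bar> \<le> 1"
    and \<tau>: "\<And>z. z \<in> S' \<Longrightarrow> \<phi> z \<noteq> 0 \<Longrightarrow> \<tau> z \<in> S"
    and B: "\<And>b. b \<in> B \<Longrightarrow> (\<lambda>z. \<phi> z * b (\<tau> z)) \<in> uspan S' B'"
  shows "(\<lambda>z. \<phi> z * f (\<tau> z)) \<in> uspan S' B'"
  using assms(1)
proof induction
  case (base f)
  then show ?case by (rule B)
next
  case zero
  then show ?case by (simp add: uspan.zero)
next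
  case (add f g)
  from uspan.add[OF add.IH] show ?case by (simp add: algebra_simps)
next
  case (scale f r)
  from uspan.scale[OF scale.IH, of r] show ?case by (simp add: algebra_simps)
next
  case (lim f)
  show ?case
  proof (rule uspan.lim)
    fix e :: real assume "e > 0"
    from lim[OF this] obtain g where
      g: "(\<lambda>z. \<phi> z * g (\<tau> z)) \<in> uspan S' B'" "\<And>z. z \<in> S \<Longrightarrow> \<bar>f z - g z\<bar> < e"
      by blast
    have "\<bar>\<phi> z * f (\<tau> z) - \<phi> z * g (\<tau> z)\<bar> < e" if "z \<in> S'" for z
    proof (cases "\<phi> z = 0")
      case False
      have "\<bar>\<phi> z * f (\<tau> z) - \<phi> z * g (\<tau> z)\<bar> = \<bar>\<phi> z\<bar> * \<bar>f (\<tau> z) - g (\<tau> z)\<bar>"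
        by (simp add: abs_mult[symmetric] algebra_simps)
      also have "\<dots> \<le> \<bar>f (\<tau> z) - g (\<tau> z)\<bar>"
        using bd[OF that] by (simp add: mult_left_le_one_le)
      also have "\<dots> < e" using g(2) \<tau> that False by blast
      finally show ?thesis .
    qed (use \<open>e > 0\<close> in auto)
    with g(1) show "\<exists>h. h \<in> uspan S' B' \<and> (\<forall>z\<in>S'. \<bar>\<phi> z * f (\<tau> z) - h z\<bar> < e)"
      by blast
  qed
qed

lemma uspan_comp:
  assumes "f \<in> uspan S B"
    and "\<And>z. z \<in> S' \<Longrightarrow> \<tau> z \<in> S"
    and "\<And>b. b \<in> B \<Longrightarrow> (\<lambda>z. b (\<tau> z)) \<in> uspan S' B'"
  shows "(\<lambda>z. f (\<tau> z)) \<in> uspan S' B'"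
  using uspan_weighted_comp[of f S B S' "\<lambda>_. 1" \<tau> B'] assms by simp

lemma uspan_subset:
  assumes "f \<in> uspan S B" "\<And>b. b \<in> B \<Longrightarrow> b \<in> uspan S B'"
  shows "f \<in> uspan S B'"
  using uspan_comp[OF assms(1), of S "\<lambda>z. z" B'] assms(2) by simp

text \<open>When \<open>B\<close> is already a linear space, its closed span is just its uniform
  closure.\<close>

lemma uspan_approx:
  assumes "f \<in> uspan S B" "e > 0"
    and zero: "(\<lambda>_. 0) \<in> B"
    and add: "\<And>f g. f \<in> B \<Longrightarrow> g \<in> B \<Longrightarrow> (\<lambda>z. f z + g z) \<in> B"
    and scale: "\<And>f r. f \<in> B \<Longrightarrow> (\<lambda>z. r * f z) \<in> B"
  shows "\<exists>g\<in>B. \<forall>z\<in>S. \<bar>f z - g z\<bar> < e"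
  using assms(1,2)
proof (induction arbitrary: e)
  case (base f)
  then show ?case by (intro bexI[of _ f]) auto
next
  case zero
  then show ?case using assms(3) by (intro bexI[of _ "\<lambda>_. 0"]) auto
next
  case (add f g)
  from add.IH(1)[of "e/2"] add.IH(2)[of "e/2"] add.prems obtain f' g' where
    fg: "f' \<in> B" "g' \<in> B" "\<forall>z\<in>S. \<bar>f z - f' z\<bar> < e/2" "\<forall>z\<in>S. \<bar>g z - g' z\<bar> < e/2"
    by auto
  have "\<bar>f z + g z - (f' z + g' z)\<bar> < e" if "z \<in> S" for z
    using fg(3,4) that by (smt (verit) field_sum_of_halves)
  with assms(4)[OF fg(1,2)] show ?case by (intro bexI[of _ "\<lambda>z. f' z + g' z"]) auto
next
  case (scale f r)
  from scale.IH[of "e / (\<bar>r\<bar> + 1)"] scale.prems obtain f' where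
    f': "f' \<in> B" "\<forall>z\<in>S. \<bar>f z - f' z\<bar> < e / (\<bar>r\<bar> + 1)"
    by auto
  have "\<bar>r * f z - r * f' z\<bar> < e" if "z \<in> S" for z
  proof -
    have "\<bar>r * f z - r * f' z\<bar> = \<bar>r\<bar> * \<bar>f z - f' z\<bar>"
      by (simp add: abs_mult[symmetric] algebra_simps)
    also have "\<dots> \<le> \<bar>r\<bar> * (e / (\<bar>r\<bar> + 1))"
      using f'(2) that by (intro mult_left_mono) auto
    also have "\<dots> < e" using scale.prems by (simp add: field_simps)
    finally show ?thesis .
  qed
  with assms(5)[OF f'(1)] show ?case by (intro bexI[of _ "\<lambda>z. r * f' z"]) auto
next
  case (lim f)
  from lim.IH[of "e/2"] lim.prems obtain g where
    g: "\<And>e. e > 0 \<Longrightarrow> \<exists>h\<in>B. \<forall>z\<in>S. \<bar>g z - h z\<bar> < e" "\<forall>z\<in>S. \<bar>f z - g z\<bar> < e/2"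
    by auto
  from g(1)[of "e/2"] lim.prems obtain h where h: "h \<in> B" "\<forall>z\<in>S. \<bar>g z - h z\<bar> < e/2"
    by auto
  have "\<bar>f z - h z\<bar> < e" if "z \<in> S" for z
    using g(2) h(2) that by (smt (verit) field_sum_of_halves)
  with h(1) show ?case by auto
qed

text \<open>The closed span of a multiplicative set is closed under products of continuous elements,
  so the classical theorem for algebras applies to it.\<close>

lemma uspan_Stone_Weierstrass:
  fixes S :: "'a::t2_space set"
  assumes S: "compact S"
    and cont: "\<And>b. b \<in> B \<Longrightarrow> continuous_on S b"
    and one: "(\<lambda>_. 1) \<in> B"
    and mult: "\<And>b b'. b \<in> B \<Longrightarrow> b' \<in> B \<Longrightarrow> (\<lambda>z. b z * b' z) \<in> B"
    and sep: "\<And>x y. x \<in> S \<Longrightarrow> y \<in> S \<Longrightarrow> x \<noteq> y \<Longrightarrow> \<exists>b\<in>B. b x \<noteq> b y"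
    and f: "continuous_on S f"
  shows "f \<in> uspan S B"
proof -
  \<comment> \<open>Membership demands that products with continuous span elements stay in the span;
    this makes \<open>R\<close> a function ring.\<close>
  define R where "R = {f. continuous_on S f \<and> f \<in> uspan S B \<and> (\<forall>g. continuous_on S g \<longrightarrow> g \<in> uspan S B \<longrightarrow> (\<lambda>z. f z * g z) \<in> uspan S B)}"
  have bounded_mult: "(\<lambda>z. f z * g z) \<in> uspan S B"
    if fc: "continuous_on S f" and *: "\<And>b. b \<in> B \<Longrightarrow> (\<lambda>z. f z * b z) \<in> uspan S B" and g: "g \<in> uspan S B" for f g
  proof -
    obtain C where C: "C > 0" "\<And>z. z \<in> S \<Longrightarrow> \<bar>f z\<bar> \<le> C"
      using compact_imp_bounded[OF compact_continuous_image[OF fc S]]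
      by (auto simp: bounded_pos)
    \<comment> \<open>Dividing by the bound \<open>C\<close> makes the weight at most 1 in absolute
      value, as \<open>uspan_weighted_comp\<close> requires.\<close>
    have "(\<lambda>z. f z / C * g z) \<in> uspan S B"
    proof (rule uspan_weighted_comp[OF g])
      fix b assume "b \<in> B"
      then show "(\<lambda>z. f z / C * b z) \<in> uspan S B"
        using uspan.scale[OF *, of b "1/C"] by simp
    qed (use C in auto)
    from uspan.scale[OF this, of C] show ?thesis using C(1) by simp
  qed
  have BR: "b \<in> R" if "b \<in> B" for b
  proof -
    have "(\<lambda>z. b z * g z) \<in> uspan S B" if "g \<in> uspan S B" for g
      by (rule bounded_mult[OF cont[OF \<open>b \<in> B\<close>] _ that]) (rule uspan.base[OF mult[OF \<open>b \<in> B\<close>]])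
    then show ?thesis
      unfolding R_def using cont[OF that] uspan.base[OF that] by blast
  qed
  \<comment> \<open>Bootstrapping: \<open>BR\<close> covers a generator times a span element. By
    commutativity this is a span element times a generator, and \<open>bounded_mult\<close> extends
    the second factor to the whole span.\<close>
  have mem: "f \<in> R" if "continuous_on S f" "f \<in> uspan S B" for f
  proof -
    have "(\<lambda>z. f z * b z) \<in> uspan S B" if "b \<in> B" for b
    proof -
      have "(\<lambda>z. b z * f z) \<in> uspan S B"
        using BR[OF that] \<open>continuous_on S f\<close> \<open>f \<in> uspan S B\<close> unfolding R_def by blast
      then show ?thesis by (simp add: mult.commute)
    qed
    then show ?thesis unfolding R_def using that bounded_mult by blast
  qed
  interpret function_ring_on R S
  proof
    show "(\<lambda>_. c) \<in> R" for c
    proof (rule mem)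
      show "(\<lambda>_. c) \<in> uspan S B" using uspan.scale[OF uspan.base[OF one], of c] by simp
    qed auto
    show "\<exists>f\<in>R. f x \<noteq> f y" if "x \<in> S" "y \<in> S" "x \<noteq> y" for x y
      using sep[OF that] BR by blast
    show "(\<lambda>x. f x + g x) \<in> R" if "f \<in> R" "g \<in> R" for f g
      using that by (intro mem) (auto simp: R_def intro!: continuous_intros uspan.add)
    show "(\<lambda>x. f x * g x) \<in> R" if "f \<in> R" "g \<in> R" for f g
      using that by (intro mem) (auto simp: R_def intro!: continuous_intros)
  qed (use S in \<open>auto simp: R_def\<close>)
  obtain F where F: "F \<in> UNIV \<rightarrow> R" "LIM n sequentially. F n :> uniformly_on S f"
    using Stone_Weierstrass[OF f] by blast
  show ?thesis
  proof (rule uspan.lim)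
    fix e :: real assume "e > 0"
    with F(2) have "\<forall>\<^sub>F n in sequentially. \<forall>x\<in>S. dist (F n x) (f x) < e"
      by (simp add: uniform_limit_iff)
    then obtain n where "\<forall>x\<in>S. dist (F n x) (f x) < e"
      using eventually_happens'[OF sequentially_bot] by blast
    moreover have "F n \<in> uspan S B" using F(1) by (auto simp: R_def)
    ultimately show "\<exists>g. g \<in> uspan S B \<and> (\<forall>z\<in>S. \<bar>f z - g z\<bar> < e)"
      by (auto simp: dist_real_def abs_minus_commute)
  qed
qed

section \<open>Universal approximation on an interval\<close>

text \<open>Endpoints are unordered and may coincide, since increments such as
  \<open>\<eta> * x\<close> below can have either sign or vanish.\<close>

lemma mean_value_between:
  fixes F :: "real \<Rightarrow> real"
  assumes "\<And>t. (F has_real_derivative F' t) (at t)"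
  obtains \<xi> where "min u v \<le> \<xi>" "\<xi> \<le> max u v" "F v - F u = (v - u) * F' \<xi>"
proof -
  consider "u < v" | "v < u" | "u = v" by linarith
  then show thesis
  proof cases
    case 1
    then obtain z where "u < z" "z < v" "F v - F u = (v - u) * F' z"
      using MVT2[OF 1, of F F'] assms by blast
    then show thesis by (intro that[of z]) auto
  next
    case 2
    then obtain z where "v < z" "z < u" "F u - F v = (u - v) * F' z"
      using MVT2[OF 2, of F F'] assms by blast
    then show thesis by (intro that[of z]) (auto simp: algebra_simps)
  qed (use that[of u] in auto)
qed

lemma continuous_antiderivative:
  fixes f :: "real \<Rightarrow> real"
  assumes "continuous_on UNIV f"
  obtains G where "\<And>t. (G has_real_derivative f t) (at t)"
proof -
  have "\<exists>F. \<forall>x::real. -\<infinity> < ereal x \<longrightarrow> ereal x < \<infinity> \<longrightarrow> (F has_vector_derivative f x) (at x)"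
    using assms by (intro einterval_antiderivative) (auto simp: continuous_on_eq_continuous_at)
  then show thesis
    using that by (auto simp: has_real_derivative_iff_has_vector_derivative)
qed

lemma uniform_modulus:
  fixes f :: "real \<Rightarrow> real"
  assumes "continuous_on UNIV f" "e > 0"
  obtains \<delta> where "\<delta> > 0"
    "\<And>u v. \<bar>u\<bar> \<le> R \<Longrightarrow> \<bar>v\<bar> \<le> R \<Longrightarrow> \<bar>u - v\<bar> < \<delta> \<Longrightarrow> \<bar>f u - f v\<bar> < e"
proof -
  have "uniformly_continuous_on {-R..R} f"
    using assms(1) by (intro compact_uniformly_continuous) (auto intro: continuous_on_subset)
  then obtain \<delta> where "\<delta> > 0" "\<forall>x\<in>{-R..R}. \<forall>x'\<in>{-R..R}. dist x' x < \<delta> \<longrightarrow> dist (f x') (f x) < e"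
    using assms(2) unfolding uniformly_continuous_on_def by metis
  then show thesis by (intro that[of \<delta>]) (auto simp: dist_real_def abs_le_iff)
qed

lemma power_bound_on_interval:
  fixes M :: real
  obtains C where "C > 0" "\<And>x. x \<in> {-M..M} \<Longrightarrow> \<bar>x ^ j\<bar> \<le> C"
proof
  show "\<bar>M\<bar> ^ j + 1 > 0" by (smt (verit) zero_le_power)
  fix x assume "x \<in> {-M..M}"
  then have "\<bar>x\<bar> ^ j \<le> \<bar>M\<bar> ^ j" by (intro power_mono) auto
  then show "\<bar>x ^ j\<bar> \<le> \<bar>M\<bar> ^ j + 1" by (simp add: power_abs)
qed

lemma abs_affine_le:
  fixes a b x M :: real
  assumes "x \<in> {-M..M}"
  shows "\<bar>a * x + b\<bar> \<le> \<bar>a\<bar> * M + \<bar>b\<bar>"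
proof -
  have "\<bar>a * x\<bar> \<le> \<bar>a\<bar> * M"
    using assms by (auto simp: abs_mult intro!: mult_left_mono)
  then show ?thesis by linarith
qed

text \<open>The difference of \<open>G\<close> is the integral of \<open>f\<close> over an interval
  of length \<open>h\<close>. Its Riemann sums combine functions from \<open>V\<close> with
  translated \<open>b\<close>, and they converge uniformly because \<open>f\<close> is uniformly
  continuous on the bounded range of arguments.\<close>

lemma uspan_integral:
  fixes f :: "real \<Rightarrow> real"
  assumes f: "continuous_on UNIV f"
    and V: "\<And>a b. (\<lambda>x. x ^ j * f (a * x + b)) \<in> uspan {-M..M} B"
    and G: "\<And>t. (G has_real_derivative f t) (at t)"
    and h: "h \<ge> 0"
  shows "(\<lambda>x. x ^ j * (G (a * x + b + h) - G (a * x + b))) \<in> uspan {-M..M} B"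
proof (rule uspan.lim)
  fix e :: real assume "e > 0"
  obtain C where C: "C > 0" "\<And>x. x \<in> {-M..M} \<Longrightarrow> \<bar>x ^ j\<bar> \<le> C"
    using power_bound_on_interval by blast
  \<comment> \<open>The summand 1 covers \<open>h = 0\<close> and leaves the final bound
    \<open>e * (h / (h + 1))\<close>, strictly below \<open>e\<close>.\<close>
  define e' where "e' = e / (C * (h + 1))"
  have "e' > 0" using \<open>e > 0\<close> C h by (simp add: e'_def)
  from uniform_modulus[OF f this, of "\<bar>a\<bar> * M + \<bar>b\<bar> + h"] obtain \<delta> where \<delta>: "\<delta> > 0"
    "\<And>u v. \<bar>u\<bar> \<le> \<bar>a\<bar> * M + \<bar>b\<bar> + h \<Longrightarrow> \<bar>v\<bar> \<le> \<bar>a\<bar> * M + \<bar>b\<bar> + h \<Longrightarrow> \<bar>u - v\<bar> < \<delta> \<Longrightarrow> \<bar>f u - f v\<bar> < e'"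
    by blast
  obtain n :: nat where n: "h / \<delta> < real n" using reals_Archimedean2 by blast
  have n0: "n > 0" using n h \<delta>(1) by (metis divide_nonneg_pos less_le_not_le not_gr_zero of_nat_0)
  have hn: "h / n < \<delta>" using n n0 \<delta>(1) by (simp add: field_simps)
  define g where "g x = (\<Sum>i<n. h / n * (x ^ j * f (a * x + (b + i * (h / n)))))" for x
  have "g \<in> uspan {-M..M} B"
    unfolding g_def[abs_def] by (intro uspan_sum uspan.scale V)
  moreover have "\<bar>x ^ j * (G (a * x + b + h) - G (a * x + b)) - g x\<bar> < e" if x: "x \<in> {-M..M}" for x
  proof -
    define t where "t = a * x + b"
    have tb: "\<bar>t\<bar> \<le> \<bar>a\<bar> * M + \<bar>b\<bar>" using abs_affine_le[OF x] by (simp add: t_def)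
    have riemann: "\<bar>G (t + Suc i * (h/n)) - G (t + i * (h/n)) - h/n * f (t + i * (h/n))\<bar> \<le> h/n * e'"
      if "i < n" for i
    proof -
      obtain \<xi> where \<xi>: "min (t + i * (h/n)) (t + Suc i * (h/n)) \<le> \<xi>"
        "\<xi> \<le> max (t + i * (h/n)) (t + Suc i * (h/n))"
        "G (t + Suc i * (h/n)) - G (t + i * (h/n)) = (t + Suc i * (h/n) - (t + i * (h/n))) * f \<xi>"
        using mean_value_between[of G f "t + i * (h/n)" "t + Suc i * (h/n)"] G by blast
      have hn0: "0 \<le> h / n" using h by simp
      have st: "t + Suc i * (h/n) = t + i * (h/n) + h/n" by (simp add: algebra_simps add_divide_distrib)
      have "real (Suc i) * (h/n) \<le> real n * (h/n)"
        using that hn0 by (intro mult_right_mono) auto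
      then have up: "i * (h/n) + h/n \<le> h" using n0 by (simp add: algebra_simps add_divide_distrib)
      have lo: "0 \<le> i * (h/n)" by (intro mult_nonneg_nonneg hn0) simp
      have \<xi>': "t + i * (h/n) \<le> \<xi>" "\<xi> \<le> t + i * (h/n) + h/n"
        using \<xi>(1,2) hn0 unfolding st by (auto simp: min_def max_def split: if_splits)
      have "\<bar>f \<xi> - f (t + i * (h/n))\<bar> < e'"
      proof (rule \<delta>(2))
        show "\<bar>\<xi>\<bar> \<le> \<bar>a\<bar> * M + \<bar>b\<bar> + h" "\<bar>t + i * (h/n)\<bar> \<le> \<bar>a\<bar> * M + \<bar>b\<bar> + h"
          "\<bar>\<xi> - (t + i * (h/n))\<bar> < \<delta>"
          using \<xi>' hn tb up lo hn0 by (smt (verit))+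
      qed
      then have "h/n * \<bar>f \<xi> - f (t + i * (h/n))\<bar> \<le> h/n * e'"
        using hn0 by (intro mult_left_mono) auto
      moreover have "\<bar>h/n * (f \<xi> - f (t + i * (h/n)))\<bar> = h/n * \<bar>f \<xi> - f (t + i * (h/n))\<bar>"
        by (simp only: abs_mult abs_of_nonneg[OF hn0])
      moreover have "G (t + Suc i * (h/n)) - G (t + i * (h/n)) - h/n * f (t + i * (h/n))
          = h/n * (f \<xi> - f (t + i * (h/n)))"
        using \<xi>(3) unfolding st by (simp add: right_diff_distrib)
      ultimately show ?thesis by (simp only:)
    qed
    have tel: "G (t + h) - G t = (\<Sum>i<n. G (t + Suc i * (h/n)) - G (t + i * (h/n)))"
      using sum_lessThan_telescope[of "\<lambda>i. G (t + i * (h/n))" n] n0 by simp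
    have gx: "g x = x ^ j * (\<Sum>i<n. h/n * f (t + i * (h/n)))"
      unfolding g_def t_def by (simp add: sum_distrib_left algebra_simps)
    have "\<bar>G (t + h) - G t - (\<Sum>i<n. h/n * f (t + i * (h/n)))\<bar> \<le>
      (\<Sum>i<n. \<bar>G (t + Suc i * (h/n)) - G (t + i * (h/n)) - h/n * f (t + i * (h/n))\<bar>)"
      unfolding tel sum_subtractf[symmetric] by (rule sum_abs)
    also have "\<dots> \<le> (\<Sum>i<n. h/n * e')" using riemann by (intro sum_mono) auto
    also have "\<dots> = h * e'" using n0 by simp
    finally have 1: "\<bar>G (t + h) - G t - (\<Sum>i<n. h/n * f (t + i * (h/n)))\<bar> \<le> h * e'" .
    have "\<bar>x ^ j * (G (t + h) - G t) - g x\<bar> = \<bar>x ^ j\<bar> * \<bar>G (t + h) - G t - (\<Sum>i<n. h/n * f (t + i * (h/n)))\<bar>"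
      unfolding gx by (simp add: abs_mult[symmetric] right_diff_distrib)
    also have "\<dots> \<le> C * (h * e')"
      using C 1 x by (intro mult_mono) auto
    also have "\<dots> = e * (h / (h + 1))" using C(1) by (simp add: e'_def)
    also have "\<dots> < e" using h \<open>e > 0\<close> by (simp add: field_simps)
    finally show ?thesis by (simp add: t_def)
  qed
  ultimately show "\<exists>g. g \<in> uspan {-M..M} B \<and>
      (\<forall>x\<in>{-M..M}. \<bar>x ^ j * (G (a * x + b + h) - G (a * x + b)) - g x\<bar> < e)"
    by blast
qed

text \<open>Differentiating \<open>F (a * x + b)\<close> in the slope \<open>a\<close> produces a
  factor \<open>x\<close>. The difference quotients in \<open>a\<close> lie in the span and converge
  uniformly by the mean value theorem.\<close>

lemma uspan_parameter_derivative:
  fixes F :: "real \<Rightarrow> real"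
  assumes F: "\<And>t. (F has_real_derivative F' t) (at t)"
    and F': "continuous_on UNIV F'"
    and V: "\<And>a b. (\<lambda>x. x ^ j * F (a * x + b)) \<in> uspan {-M..M} B"
  shows "(\<lambda>x. x ^ Suc j * F' (a * x + b)) \<in> uspan {-M..M} B"
proof (rule uspan.lim)
  fix e :: real assume "e > 0"
  obtain C where C: "C > 0" "\<And>x. x \<in> {-M..M} \<Longrightarrow> \<bar>x ^ Suc j\<bar> \<le> C"
    using power_bound_on_interval by blast
  define R where "R = (\<bar>a\<bar> + 1) * M + \<bar>b\<bar>"
  have "e / C > 0" using \<open>e > 0\<close> C by simp
  from uniform_modulus[OF F' this, of R] obtain \<delta> where \<delta>: "\<delta> > 0"
    "\<And>u v. \<bar>u\<bar> \<le> R \<Longrightarrow> \<bar>v\<bar> \<le> R \<Longrightarrow> \<bar>u - v\<bar> < \<delta> \<Longrightarrow> \<bar>F' u - F' v\<bar> < e / C"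
    by blast
  \<comment> \<open>The bound 1 keeps the perturbed argument within \<open>R\<close>; the other
    bound moves it by less than \<open>\<delta>\<close>.\<close>
  define \<eta> where "\<eta> = min 1 (\<delta> / (\<bar>M\<bar> + 1))"
  have \<eta>: "\<eta> > 0" "\<eta> \<le> 1" "\<eta> * \<bar>M\<bar> < \<delta>"
  proof -
    show "\<eta> > 0" "\<eta> \<le> 1" using \<delta>(1) by (auto simp: \<eta>_def)
    have "\<eta> * \<bar>M\<bar> \<le> \<delta> / (\<bar>M\<bar> + 1) * \<bar>M\<bar>" by (intro mult_right_mono) (auto simp: \<eta>_def)
    also have "\<dots> < \<delta>" using \<delta>(1) by (simp add: field_simps)
    finally show "\<eta> * \<bar>M\<bar> < \<delta>" .
  qed
  define g where "g x = 1 / \<eta> * (x ^ j * F ((a + \<eta>) * x + b) - x ^ j * F (a * x + b))" for x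
  have "g \<in> uspan {-M..M} B"
    unfolding g_def[abs_def] by (intro uspan.scale uspan_diff V)
  moreover have "\<bar>x ^ Suc j * F' (a * x + b) - g x\<bar> < e" if x: "x \<in> {-M..M}" for x
  proof -
    define u v where "u = a * x + b" and "v = (a + \<eta>) * x + b"
    have M: "M \<ge> 0" using x by auto
    have vu: "v - u = \<eta> * x" by (simp add: u_def v_def algebra_simps)
    have "\<bar>u\<bar> \<le> \<bar>a\<bar> * M + \<bar>b\<bar>" using abs_affine_le[OF x] by (simp add: u_def)
    also have "\<dots> \<le> R" using M by (simp add: R_def algebra_simps)
    finally have uR: "\<bar>u\<bar> \<le> R" .
    have "\<bar>v\<bar> \<le> \<bar>a + \<eta>\<bar> * M + \<bar>b\<bar>" using abs_affine_le[OF x] by (simp add: v_def)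
    also have "\<dots> \<le> R" using M \<eta> by (auto simp: R_def intro!: mult_right_mono)
    finally have vR: "\<bar>v\<bar> \<le> R" .
    obtain \<xi> where \<xi>: "min u v \<le> \<xi>" "\<xi> \<le> max u v" "F v - F u = (v - u) * F' \<xi>"
      using mean_value_between[of F F' u v] F by blast
    have "\<bar>v - u\<bar> \<le> \<eta> * \<bar>M\<bar>" using x \<eta> by (auto simp: vu abs_mult intro!: mult_left_mono)
    then have "\<bar>u - \<xi>\<bar> < \<delta>" using \<xi>(1,2) \<eta>(3) by (auto simp: min_def max_def split: if_splits)
    moreover have "\<bar>\<xi>\<bar> \<le> R" using uR vR \<xi>(1,2) by (auto simp: min_def max_def split: if_splits)
    ultimately have d: "\<bar>F' u - F' \<xi>\<bar> < e / C" using \<delta>(2) uR by blast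
    have "g x = x ^ j * ((F v - F u) / \<eta>)" by (simp add: g_def u_def v_def algebra_simps diff_divide_distrib)
    also have "\<dots> = x ^ Suc j * F' \<xi>" using \<eta>(1) by (simp add: \<xi>(3) vu)
    finally have "\<bar>x ^ Suc j * F' u - g x\<bar> = \<bar>x ^ Suc j\<bar> * \<bar>F' u - F' \<xi>\<bar>"
      by (simp only: abs_mult[symmetric] right_diff_distrib)
    also have "\<dots> \<le> C * \<bar>F' u - F' \<xi>\<bar>" using C(2)[OF x] by (intro mult_right_mono) auto
    also have "\<dots> < C * (e / C)" using d C(1) by (intro mult_strict_left_mono) auto
    also have "\<dots> = e" using C(1) by simp
    finally show ?thesis by (simp add: u_def)
  qed
  ultimately show "\<exists>g. g \<in> uspan {-M..M} B \<and> (\<forall>x\<in>{-M..M}. \<bar>x ^ Suc j * F' (a * x + b) - g x\<bar> < e)"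
    by blast
qed

text \<open>A merely continuous \<open>f\<close> cannot be differentiated in the slope, but the
  smoothed function \<open>G (t + h) - G t\<close> can: it lies in the span by
  \<open>uspan_integral\<close>, and its derivative is the difference of \<open>f\<close>.\<close>

lemma uspan_difference:
  fixes f :: "real \<Rightarrow> real"
  assumes f: "continuous_on UNIV f"
    and V: "\<And>a b. (\<lambda>x. x ^ j * f (a * x + b)) \<in> uspan {-M..M} B"
    and h: "h \<ge> 0"
  shows "(\<lambda>x. x ^ Suc j * (f (a * x + b + h) - f (a * x + b))) \<in> uspan {-M..M} B"
proof -
  obtain G where G: "\<And>t. (G has_real_derivative f t) (at t)"
    using continuous_antiderivative[OF f] by blast
  have "((\<lambda>t. G (t + h) - G t) has_real_derivative f (t + h) - f t) (at t)" for t
    by (intro derivative_intros G) (use G[of "t + h"] in \<open>simp add: DERIV_shift\<close>)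
  moreover have "continuous_on UNIV (\<lambda>t. f (t + h) - f t)"
    by (intro continuous_intros continuous_on_compose2[OF f]) auto
  ultimately show ?thesis
    using uspan_parameter_derivative[of "\<lambda>t. G (t + h) - G t" "\<lambda>t. f (t + h) - f t" j M B a b]
      uspan_integral[OF f V G h] by blast
qed

text \<open>Frechet's functional equation: the \<open>k\<close>-fold differences vanish, with
  nonnegative steps chosen independently at each stage. Among continuous functions it singles out
  the polynomials of degree less than \<open>k\<close>.\<close>

primrec null_differences :: "nat \<Rightarrow> (real \<Rightarrow> real) \<Rightarrow> bool" where
  "null_differences 0 f \<longleftrightarrow> (\<forall>t. f t = 0)"
| "null_differences (Suc k) f \<longleftrightarrow> (\<forall>h\<ge>0. null_differences k (\<lambda>t. f (t + h) - f t))"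

text \<open>Taking differences in \<open>t\<close> commutes with integrating over
  \<open>s\<close>.\<close>

lemma null_differences_integral:
  fixes g :: "real \<Rightarrow> real \<Rightarrow> real"
  assumes "\<And>s. s \<in> {0..1} \<Longrightarrow> null_differences k (g s)"
    and "\<And>t. (\<lambda>s. g s t) integrable_on {0..1}"
  shows "null_differences k (\<lambda>t. integral {0..1} (\<lambda>s. g s t))"
  using assms
proof (induction k arbitrary: g)
  case 0
  have "integral {0..1} (\<lambda>s. g s t) = integral {0..1} (\<lambda>s::real. 0::real)" for t
    by (rule Henstock_Kurzweil_Integration.integral_cong) (use 0 in auto)
  then show ?case by simp
next
  case (Suc k)
  have "null_differences k (\<lambda>t. integral {0..1} (\<lambda>s. g s (t + h)) - integral {0..1} (\<lambda>s. g s t))"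
    if "h \<ge> 0" for h
  proof -
    have "null_differences k (\<lambda>t. integral {0..1} (\<lambda>s. g s (t + h) - g s t))"
      using Suc.prems that by (intro Suc.IH) (auto intro: integrable_diff)
    then show ?thesis by (simp add: integral_diff Suc.prems(2))
  qed
  then show ?case by simp
qed

lemma poly_antiderivative:
  fixes p :: "real poly"
  obtains q where "pderiv q = p"
proof
  have "pderiv (\<Sum>i\<le>degree p. monom (coeff p i / Suc i) (Suc i)) = (\<Sum>i\<le>degree p. monom (coeff p i) i)"
    unfolding higher_pderiv_sum[of 1, simplified]
    by (intro sum.cong) (auto simp: pderiv_monom simp del: of_nat_Suc)
  then show "pderiv (\<Sum>i\<le>degree p. monom (coeff p i / Suc i) (Suc i)) = p"
    by (simp add: poly_as_sum_of_monoms)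
qed

text \<open>With \<open>Q t = \<integral>\<^sub>t\<^sup>t\<^sup>+\<^sup>1 f\<close> and
  \<open>R t = \<integral>\<^sub>0\<^sup>1 (f (t + s) - f t) ds\<close> one has \<open>f = Q - R\<close>, and both \<open>R\<close> and the
  derivative of \<open>Q\<close> have one order of differences less to control.\<close>

lemma null_differences_imp_poly:
  assumes "continuous_on UNIV f" "null_differences k f"
  shows "\<exists>p. \<forall>t. f t = poly p t"
  using assms
proof (induction k arbitrary: f)
  case 0
  then show ?case by (intro exI[of _ 0]) auto
next
  case (Suc k)
  note f = Suc.prems(1)
  obtain G where G: "\<And>t. (G has_real_derivative f t) (at t)"
    using continuous_antiderivative[OF f] by blast
  define Q where "Q t = G (t + 1) - G t" for t
  have Qint: "((\<lambda>s. f (t + s)) has_integral Q t) {0..1}" for t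
  proof -
    have "((\<lambda>s. G (t + s)) has_real_derivative f (t + s)) (at s)" for s
      using G[of "t + s"] DERIV_shift[of G "f (t + s)" s t] by (simp add: add.commute)
    then show ?thesis
      using fundamental_theorem_of_calculus[of 0 1 "\<lambda>s. G (t + s)" "\<lambda>s. f (t + s)"]
      by (simp add: Q_def has_real_derivative_iff_has_vector_derivative[symmetric]
          has_field_derivative_at_within)
  qed
  have "null_differences k (\<lambda>t. f (t + 1) - f t)" using Suc.prems(2) by simp
  moreover have "continuous_on UNIV (\<lambda>t. f (t + 1) - f t)"
    by (intro continuous_intros continuous_on_compose2[OF f]) auto
  ultimately obtain p where p: "\<And>t. f (t + 1) - f t = poly p t"
    using Suc.IH by metis
  obtain q where q: "pderiv q = p" by (rule poly_antiderivative)
  have Q': "(Q has_real_derivative f (t + 1) - f t) (at t)" for t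
    unfolding Q_def[abs_def]
    by (intro derivative_intros G) (use G[of "t + 1"] in \<open>simp add: DERIV_shift\<close>)
  have "((\<lambda>t. Q t - poly q t) has_real_derivative 0) (at t)" for t
    using DERIV_diff[OF Q'[of t] poly_DERIV[of q t]] by (simp add: p q)
  then have "Q t - poly q t = Q 0 - poly q 0" for t
    using DERIV_isconst_all[of "\<lambda>t. Q t - poly q t"] by blast
  then have Qp: "Q t = poly (q + [:Q 0 - poly q 0:]) t" for t
    by (simp add: algebra_simps)
  define R where "R t = Q t - f t" for t
  have "R t = integral {0..1} (\<lambda>s. f (t + s) - f t)" for t
    using has_integral_diff[OF Qint[of t] has_integral_const_real[of "f t" 0 1]]
    by (simp add: R_def integral_unique)
  then have R_eq: "R = (\<lambda>t. integral {0..1} (\<lambda>s. f (t + s) - f t))" by blast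
  \<comment> \<open>Each \<open>s\<close> in \<open>{0..1}\<close> is an admissible nonnegative
    step, so the integrand is null of order \<open>k\<close> in \<open>t\<close>.\<close>
  have "null_differences k (\<lambda>t. integral {0..1} (\<lambda>s. f (t + s) - f t))"
    using Suc.prems(2) Qint
    by (intro null_differences_integral integrable_diff) (auto simp: has_integral_integrable)
  then have "null_differences k R" by (simp only: R_eq)
  moreover have "continuous_on UNIV R"
    unfolding R_def[abs_def] using Q' f
    by (intro continuous_intros) (auto simp: continuous_on_eq_continuous_at intro: DERIV_isCont)
  ultimately obtain r where r: "\<And>t. R t = poly r t" using Suc.IH by blast
  have "f t = poly (q + [:Q 0 - poly q 0:] - r) t" for t
    using Qp[of t] r[of t] by (simp add: R_def)
  then show ?case by blast
qed

text \<open>Each difference lowers the order by one and, by \<open>uspan_difference\<close>, gains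
  one factor \<open>x\<close>. After \<open>k\<close> of them a function that is not identically
  zero remains.\<close>

lemma power_in_uspan:
  assumes "continuous_on UNIV f" "\<not> null_differences k f"
    and "\<And>a b. (\<lambda>x. x ^ j * f (a * x + b)) \<in> uspan {-M..M} B"
  shows "(\<lambda>x. x ^ (j + k)) \<in> uspan {-M..M} B"
  using assms
proof (induction k arbitrary: f j)
  case 0
  then obtain b where b: "f b \<noteq> 0" by auto
  \<comment> \<open>Slope 0 turns the remaining function into the nonzero constant
    \<open>f b\<close>.\<close>
  have "(\<lambda>x. 1 / f b * (x ^ j * f (0 * x + b))) \<in> uspan {-M..M} B"
    using 0 by (intro uspan.scale) blast
  then show ?case using b by simp
next
  case (Suc k)
  then obtain h where h: "h \<ge> 0" "\<not> null_differences k (\<lambda>t. f (t + h) - f t)" by auto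
  have "continuous_on UNIV (\<lambda>t. f (t + h) - f t)"
    by (intro continuous_intros continuous_on_compose2[OF Suc.prems(1)]) auto
  then have "(\<lambda>x. x ^ (Suc j + k)) \<in> uspan {-M..M} B"
    using h uspan_difference[OF Suc.prems(1,3) h(1)] by (intro Suc.IH) auto
  then show ?case by simp
qed

text \<open>No order of differences of \<open>\<sigma>\<close> vanishes, so all monomials lie in the
  closed span, and they are dense by Stone--Weierstrass.\<close>

lemma ridge_universal:
  fixes \<sigma> \<phi> :: "real \<Rightarrow> real"
  assumes \<sigma>: "continuous_on UNIV \<sigma>" "\<not> (\<exists>p. \<forall>t. \<sigma> t = poly p t)"
    and \<phi>: "continuous_on {-M..M} \<phi>"
  shows "\<phi> \<in> uspan {-M..M} {\<lambda>t. \<sigma> (a * t + b) | a b. True}" (is "_ \<in> ?V")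
proof -
  have "\<not> null_differences k \<sigma>" for k
    using null_differences_imp_poly[OF \<sigma>(1)] \<sigma>(2) by blast
  then have pow: "(\<lambda>x. x ^ k) \<in> ?V" for k
    using power_in_uspan[of \<sigma> k 0 M "{\<lambda>t. \<sigma> (a * t + b) | a b. True}", OF \<sigma>(1)]
    by (simp, metis (mono_tags, lifting) mem_Collect_eq uspan.base)
  have "\<phi> \<in> uspan {-M..M} (range (\<lambda>k x. x ^ k))"
  proof (rule uspan_Stone_Weierstrass)
    show "(\<lambda>_. 1) \<in> range (\<lambda>k (x::real). x ^ k)"
      by (rule image_eqI[of _ _ 0]) auto
    show "(\<lambda>z. b z * b' z) \<in> range (\<lambda>k x. x ^ k)"
      if "b \<in> range (\<lambda>k x. x ^ k)" "b' \<in> range (\<lambda>k x. x ^ k)" for b b' :: "real \<Rightarrow> real"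
      using that by (auto simp: power_add[symmetric])
    show "\<exists>b\<in>range (\<lambda>k x. x ^ k). b x \<noteq> b y" if "x \<noteq> y" for x y :: real
      using that by (intro bexI[of _ "\<lambda>x. x ^ 1"] rangeI) simp
  qed (auto intro!: continuous_intros \<phi>)
  then show ?thesis by (rule uspan_subset) (use pow in auto)
qed

section \<open>The space of tensors\<close>

lemma tensor_dist_less_iff:
  "e > 0 \<Longrightarrow> tensor_dist c d x y < e \<longleftrightarrow> (\<forall>i\<in>{1..c}. \<forall>m\<in>{1..int d}. \<bar>x i m - y i m\<bar> < e)"
  unfolding tensor_dist_def by (subst Max_less_iff) auto

lemma continuous_on_entry [continuous_intros]: "continuous_on S (\<lambda>x :: tensor. x i m)"
  by (rule continuous_on_product_then_coordinatewise[OF continuous_on_product_then_coordinatewise[OF continuous_on_id]])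

text \<open>The distance is a maximum over finitely many entries and all other entries vanish, so it
  induces the product topology. Compactness and continuity can then be treated with
  \<open>compact\<close> and \<open>continuous_on\<close>.\<close>

lemma mtopology_tensor_metric: "mtopology_of (tensor_metric c d) = top_of_set (tensors c d)"
proof (rule topology_eq[THEN iffD2], intro allI iffI)
  interpret Metric_space "tensors c d" "tensor_dist c d" by (rule Metric_space_tensor_dist)
  have mt: "mtopology_of (tensor_metric c d) = mtopology" by (simp add: mtopology_of_def)
  fix U assume U: "openin (mtopology_of (tensor_metric c d)) U"
  show "openin (top_of_set (tensors c d)) U"
  proof (subst openin_subopen, intro ballI)
    fix x assume x: "x \<in> U"
    then obtain e where e: "e > 0" "mball x e \<subseteq> U" and T: "U \<subseteq> tensors c d"
      using U unfolding mt openin_mtopology by blast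
    define V where "V = (\<Inter>i\<in>{1..c}. \<Inter>m\<in>{1..int d}. {y :: tensor. \<bar>x i m - y i m\<bar> < e})"
    have "open V"
      unfolding V_def
      by (intro open_INT ballI finite_atLeastAtMost finite_atLeastAtMost_int open_Collect_less)
        (auto intro!: continuous_intros)
    moreover have "x \<in> V" using e by (simp add: V_def)
    moreover have "tensors c d \<inter> V \<subseteq> U"
    proof
      fix y assume y: "y \<in> tensors c d \<inter> V"
      then have "tensor_dist c d x y < e" using e(1) by (auto simp: tensor_dist_less_iff V_def)
      then show "y \<in> U" using e(2) y x T by (auto simp: mball_def)
    qed
    ultimately show "\<exists>W. openin (top_of_set (tensors c d)) W \<and> x \<in> W \<and> W \<subseteq> U"
      using x T by (intro exI[of _ "tensors c d \<inter> V"]) auto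
  qed
next
  fix U assume "openin (top_of_set (tensors c d)) U"
  then obtain V where V: "open V" "U = tensors c d \<inter> V" by (auto simp: openin_open)
  let ?X = "mtopology_of (tensor_metric c d)"
  have entry: "continuous_map ?X euclidean (\<lambda>x. x i m)" for i m
  proof (cases "i \<in> {1..c} \<and> m \<in> {1..int d}")
    case True
    have "\<bar>x i m - y i m\<bar> \<le> tensor_dist c d x y" for x y
      using tensor_dist_le_iff[of c d x y "tensor_dist c d x y"] True by blast
    then have "Lipschitz_continuous_map (tensor_metric c d) euclidean_metric (\<lambda>x. x i m)"
      unfolding Lipschitz_continuous_map_def
      by (auto simp: dist_real_def intro!: exI[of _ 1])
    then show ?thesis
      using Lipschitz_continuous_imp_continuous_map by fastforce
  next
    case False
    show ?thesis
      by (rule continuous_map_eq[of _ _ "\<lambda>_. 0"]) (use False in \<open>auto simp: tensors_def\<close>)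
  qed
  have channel: "continuous_map ?X euclidean (\<lambda>x. x i)" for i
    unfolding euclidean_product_topology[symmetric]
    by (rule continuous_map_coordinatewise_then_product) (use entry[of i] in auto)
  have "continuous_map ?X euclidean (\<lambda>x. x)"
    unfolding euclidean_product_topology[symmetric]
    by (rule continuous_map_coordinatewise_then_product)
      (use channel in \<open>auto simp: euclidean_product_topology\<close>)
  then have "openin ?X {x \<in> topspace ?X. x \<in> V}"
    using V(1) by (intro openin_continuous_map_preimage) auto
  moreover have "{x \<in> topspace ?X. x \<in> V} = U" using V(2) by auto
  ultimately show "openin ?X U" by simp
qed

lemma compactin_tensor_metric:
  "compactin (mtopology_of (tensor_metric c d)) K \<longleftrightarrow> K \<subseteq> tensors c d \<and> compact K"
  unfolding mtopology_tensor_metric compactin_subtopology compactin_euclidean_iff by blast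

lemma mspace_C_metric_iff:
  assumes "compactin (mtopology_of (tensor_metric c d)) K"
  shows "f \<in> mspace (C_metric c c' d K) \<longleftrightarrow>
    f \<in> extensional K \<and> continuous_on K f \<and> f ` K \<subseteq> tensors c' d"
proof -
  have "subtopology (top_of_set (tensors c d)) K = top_of_set K"
    using assms by (simp add: compactin_tensor_metric subtopology_subtopology inf_absorb2)
  then show ?thesis
    by (auto simp: mspace_C_metric[OF assms] mtopology_tensor_metric continuous_map_in_subtopology)
qed

lemma topspace_C_metric_domain:
  assumes "compactin (mtopology_of (tensor_metric c d)) K"
  shows "topspace (subtopology (mtopology_of (tensor_metric c d)) K) = K"
  using assms[unfolded compactin_tensor_metric] by (simp add: mtopology_tensor_metric inf_absorb2)

section \<open>Algebra of convolutional networks\<close>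

lemma mk_tensor_in_tensors [simp]: "mk_tensor c d f \<in> tensors c d"
  by (auto simp: mk_tensor_def tensors_def)

lemma mk_tensor_entry [simp]:
  "i \<in> {1..c} \<Longrightarrow> m \<in> {1..int d} \<Longrightarrow> mk_tensor c d f i m = f i m"
  by (auto simp: mk_tensor_def)

lemma continuous_on_mk_tensor:
  assumes "\<And>i m. continuous_on S (\<lambda>x. f x i m)"
  shows "continuous_on S (\<lambda>x. mk_tensor c d (f x))"
proof (intro continuous_on_coordinatewise_then_product)
  fix i m
  show "continuous_on S (\<lambda>x. mk_tensor c d (f x) i m)"
    by (cases "i \<in> {1..c} \<and> m \<in> {1..int d}") (auto simp: mk_tensor_def assms)
qed

lemma conv_layers_tensors: "C \<in> conv_layers d k c1 c2 \<Longrightarrow> C x \<in> tensors c2 d"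
  unfolding conv_layers_def mem_Collect_eq by (elim exE) simp

lemma conv_layers_continuous: "C \<in> conv_layers d k c1 c2 \<Longrightarrow> continuous_on UNIV C"
  unfolding conv_layers_def mem_Collect_eq conv_def
  by (elim exE ssubst) (intro continuous_on_mk_tensor continuous_intros)

lemma cnns_tensors: "f \<in> cnns \<sigma> d k N c c' \<Longrightarrow> f x \<in> tensors c' d"
proof (induction \<sigma> d k N c c' rule: cnns.induct)
  case (2 \<sigma> d k c c')
  then show ?case by (simp add: conv_layers_tensors)
next
  case (3 \<sigma> d k N c c')
  then obtain C e g where "f = C \<circ> activation \<sigma> d e \<circ> g" "C \<in> conv_layers d k e c'"
    by auto
  then show ?case by (simp add: conv_layers_tensors)
qed simp

lemma cnns_continuous:
  assumes "continuous_on UNIV \<sigma>"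
  shows "f \<in> cnns \<sigma> d k N c c' \<Longrightarrow> continuous_on UNIV f"
  using assms
proof (induction \<sigma> d k N c c' arbitrary: f rule: cnns.induct)
  case (2 \<sigma> d k c c')
  then show ?case by (simp add: conv_layers_continuous)
next
  case (3 \<sigma> d k N c c')
  then obtain C e g where f: "f = C \<circ> activation \<sigma> d e \<circ> g" "C \<in> conv_layers d k e c'" "g \<in> cnns \<sigma> d k (Suc N) c e"
    by auto
  have "continuous_on UNIV g" using 3 f(3) by blast
  moreover have "continuous_on UNIV (activation \<sigma> d e)"
    unfolding activation_def
    by (intro continuous_on_mk_tensor continuous_on_compose2[OF 3(3)] continuous_intros) auto
  ultimately show ?case
    unfolding f(1) using conv_layers_continuous[OF f(2)]
    by (intro continuous_on_compose) (auto intro: continuous_on_subset)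
qed simp

section \<open>Channel mixing and parallel composition of networks\<close>

lemma conv_layers_nonempty: "\<exists>C. C \<in> conv_layers d k c1 c2"
  unfolding conv_layers_def by fast

lemma cnns_nonempty: "n \<ge> 1 \<Longrightarrow> \<exists>g. g \<in> cnns \<sigma> d k n c e"
proof (induction \<sigma> d k n c e rule: cnns.induct)
  case (2 \<sigma> d k c c')
  then show ?case using conv_layers_nonempty by simp
next
  case (3 \<sigma> d k N c c')
  then obtain g where "g \<in> cnns \<sigma> d k (Suc N) c 1" by force
  moreover obtain C where "C \<in> conv_layers d k 1 c'" using conv_layers_nonempty by blast
  ultimately show ?case unfolding cnns.simps by blast
qed simp

text \<open>Mixing output channels with coefficients that do not depend on the position commutes
  with convolution, so kernels and biases absorb it.\<close>

lemma conv_layers_postcompose: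
  assumes "C \<in> conv_layers d k c1 e"
  shows "(\<lambda>x. mk_tensor e' d (\<lambda>i m. (\<Sum>l = 1..e. A i l * C x l m) + \<beta> i)) \<in> conv_layers d k c1 e'"
proof -
  obtain w \<delta> where C: "C = (\<lambda>x. mk_tensor e d (\<lambda>i m. (\<Sum>j = 1..c1. conv k (w i j) (x j) m) + \<delta> i))"
    using assms by (auto simp: conv_layers_def)
  define w' where "w' i j s = (\<Sum>l = 1..e. A i l * w l j s)" for i j s
  define \<delta>' where "\<delta>' i = (\<Sum>l = 1..e. A i l * \<delta> l) + \<beta> i" for i
  have "(\<Sum>l = 1..e. A i l * C x l m) + \<beta> i = (\<Sum>j = 1..c1. conv k (w' i j) (x j) m) + \<delta>' i"
    if m: "m \<in> {1..int d}" for x i m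
  proof -
    have "(\<Sum>l = 1..e. A i l * C x l m)
        = (\<Sum>l = 1..e. A i l * (\<Sum>j = 1..c1. conv k (w l j) (x j) m)) + (\<Sum>l = 1..e. A i l * \<delta> l)"
      using m by (simp add: C distrib_left sum.distrib)
    also have "(\<Sum>l = 1..e. A i l * (\<Sum>j = 1..c1. conv k (w l j) (x j) m))
        = (\<Sum>j = 1..c1. \<Sum>l = 1..e. A i l * conv k (w l j) (x j) m)"
      unfolding sum_distrib_left by (rule sum.swap)
    also have "\<dots> = (\<Sum>j = 1..c1. conv k (w' i j) (x j) m)"
    proof (rule sum.cong[OF refl])
      fix j
      have "(\<Sum>l = 1..e. A i l * conv k (w l j) (x j) m)
          = (\<Sum>l = 1..e. \<Sum>s = - int k..int k. A i l * w l j s * x j (m - s))"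
        by (simp add: conv_def sum_distrib_left mult.assoc)
      also have "\<dots> = conv k (w' i j) (x j) m"
        unfolding conv_def w'_def sum_distrib_right by (rule sum.swap)
      finally show "(\<Sum>l = 1..e. A i l * conv k (w l j) (x j) m) = conv k (w' i j) (x j) m" .
    qed
    finally show ?thesis by (simp add: \<delta>'_def)
  qed
  then have "(\<lambda>x. mk_tensor e' d (\<lambda>i m. (\<Sum>l = 1..e. A i l * C x l m) + \<beta> i))
    = (\<lambda>x. mk_tensor e' d (\<lambda>i m. (\<Sum>j = 1..c1. conv k (w' i j) (x j) m) + \<delta>' i))"
    by (auto simp: mk_tensor_def fun_eq_iff)
  then show ?thesis by (auto simp: conv_layers_def)
qed

text \<open>The last layer absorbs the mixing, so affine operations on the output channels cost no
  depth.\<close>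

lemma cnns_postcompose:
  assumes "g \<in> cnns \<sigma> d k n c e"
  shows "(\<lambda>x. mk_tensor e' d (\<lambda>i m. (\<Sum>l = 1..e. A i l * g x l m) + \<beta> i)) \<in> cnns \<sigma> d k n c e'"
  using assms
proof (induction \<sigma> d k n c e rule: cnns.induct)
  case (2 \<sigma> d k c e)
  then show ?case using conv_layers_postcompose by simp
next
  case (3 \<sigma> d k N c c')
  then obtain C e g' where f: "g = C \<circ> activation \<sigma> d e \<circ> g'" "e \<ge> 1" "C \<in> conv_layers d k e c'" "g' \<in> cnns \<sigma> d k (Suc N) c e"
    by auto
  have "(\<lambda>x. mk_tensor e' d (\<lambda>i m. (\<Sum>l = 1..c'. A i l * g x l m) + \<beta> i))
    = (\<lambda>x. mk_tensor e' d (\<lambda>i m. (\<Sum>l = 1..c'. A i l * C x l m) + \<beta> i)) \<circ> activation \<sigma> d e \<circ> g'"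
    by (simp add: f(1) fun_eq_iff)
  then show ?case
    using conv_layers_postcompose[OF f(3), of e' A \<beta>] f(2,4) by auto
qed simp

text \<open>Concatenation along the channel axis, for running two networks of equal depth side by
  side.\<close>

definition stack :: "nat \<Rightarrow> tensor \<Rightarrow> tensor \<Rightarrow> tensor" where
  "stack e y z = (\<lambda>i. if i \<le> e then y i else z (i - e))"

lemma stack_mk_tensor:
  "stack e1 (mk_tensor e1 d f) (mk_tensor e2 d g) =
    mk_tensor (e1 + e2) d (\<lambda>i m. if i \<le> e1 then f i m else g (i - e1) m)"
  by (auto simp: stack_def mk_tensor_def fun_eq_iff)

lemma sum_split_stack:
  fixes f :: "nat \<Rightarrow> real"
  shows "(\<Sum>j = 1..a + b. f j) = (\<Sum>j = 1..a. f j) + (\<Sum>j = 1..b. f (j + a))"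
proof -
  have "(\<Sum>j = 1..a + b. f j) = (\<Sum>j = 1..a. f j) + (\<Sum>j = a + 1..a + b. f j)"
    by (rule sum.ub_add_nat) simp
  also have "(\<Sum>j = a + 1..a + b. f j) = (\<Sum>j = 1..b. f (j + a))"
    using sum.shift_bounds_cl_nat_ivl[of f 1 a b] by (simp add: add.commute)
  finally show ?thesis .
qed

lemma conv_zero_kernel [simp]: "conv k (\<lambda>_. 0) x m = 0"
  by (simp add: conv_def)

lemma conv_layers_fork:
  assumes "C1 \<in> conv_layers d k c e1" "C2 \<in> conv_layers d k c e2"
  shows "(\<lambda>x. stack e1 (C1 x) (C2 x)) \<in> conv_layers d k c (e1 + e2)"
proof -
  obtain w1 \<delta>1 where C1: "C1 = (\<lambda>x. mk_tensor e1 d (\<lambda>i m. (\<Sum>j = 1..c. conv k (w1 i j) (x j) m) + \<delta>1 i))"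
    using assms by (auto simp: conv_layers_def)
  obtain w2 \<delta>2 where C2: "C2 = (\<lambda>x. mk_tensor e2 d (\<lambda>i m. (\<Sum>j = 1..c. conv k (w2 i j) (x j) m) + \<delta>2 i))"
    using assms by (auto simp: conv_layers_def)
  show ?thesis
    unfolding conv_layers_def mem_Collect_eq C1 C2 stack_mk_tensor
    by (intro exI[of _ "\<lambda>i. if i \<le> e1 then w1 i else w2 (i - e1)"]
        exI[of _ "\<lambda>i. if i \<le> e1 then \<delta>1 i else \<delta>2 (i - e1)"])
      (auto simp: mk_tensor_def fun_eq_iff)
qed

lemma conv_layers_parallel:
  assumes "C1 \<in> conv_layers d k a1 e1" "C2 \<in> conv_layers d k a2 e2"
  obtains C where "C \<in> conv_layers d k (a1 + a2) (e1 + e2)"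
    "\<And>y z. C (stack a1 y z) = stack e1 (C1 y) (C2 z)"
proof -
  obtain w1 \<delta>1 where C1: "C1 = (\<lambda>x. mk_tensor e1 d (\<lambda>i m. (\<Sum>j = 1..a1. conv k (w1 i j) (x j) m) + \<delta>1 i))"
    using assms by (auto simp: conv_layers_def)
  obtain w2 \<delta>2 where C2: "C2 = (\<lambda>x. mk_tensor e2 d (\<lambda>i m. (\<Sum>j = 1..a2. conv k (w2 i j) (x j) m) + \<delta>2 i))"
    using assms by (auto simp: conv_layers_def)
  \<comment> \<open>A block-diagonal matrix of kernels: the two groups of channels do not
    interact.\<close>
  define w where "w i j = (if i \<le> e1 then if j \<le> a1 then w1 i j else (\<lambda>_. 0)
      else if j \<le> a1 then (\<lambda>_. 0) else w2 (i - e1) (j - a1))" for i j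
  define \<delta> where "\<delta> i = (if i \<le> e1 then \<delta>1 i else \<delta>2 (i - e1))" for i
  define C where "C x = mk_tensor (e1 + e2) d (\<lambda>i m. (\<Sum>j = 1..a1 + a2. conv k (w i j) (x j) m) + \<delta> i)" for x
  have "(\<Sum>j = 1..a1 + a2. conv k (w i j) (stack a1 y z j) m) =
      (if i \<le> e1 then \<Sum>j = 1..a1. conv k (w1 i j) (y j) m else \<Sum>j = 1..a2. conv k (w2 (i - e1) j) (z j) m)"
    for i y z m
    unfolding sum_split_stack by (simp add: w_def stack_def)
  then have "C (stack a1 y z) = stack e1 (C1 y) (C2 z)" for y z
    unfolding C_def C1 C2 stack_mk_tensor by (auto simp: \<delta>_def mk_tensor_def fun_eq_iff)
  moreover have "C \<in> conv_layers d k (a1 + a2) (e1 + e2)"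
    unfolding C_def[abs_def] conv_layers_def by blast
  ultimately show thesis using that by blast
qed

lemma activation_stack:
  "activation \<sigma> d (e1 + e2) (stack e1 y z) = stack e1 (activation \<sigma> d e1 y) (activation \<sigma> d e2 z)"
  by (auto simp: activation_def stack_def mk_tensor_def fun_eq_iff)

text \<open>The first layers read the same input and all later layers act blockwise; equal depth
  makes the blocks line up.\<close>

lemma cnns_fork:
  assumes "g1 \<in> cnns \<sigma> d k n c e1" "g2 \<in> cnns \<sigma> d k n c e2"
  shows "(\<lambda>x. stack e1 (g1 x) (g2 x)) \<in> cnns \<sigma> d k n c (e1 + e2)"
  using assms
proof (induction \<sigma> d k n c e1 arbitrary: g1 g2 e2 rule: cnns.induct)
  case (2 \<sigma> d k c e)
  then show ?case using conv_layers_fork by simp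
next
  case (3 \<sigma> d k N c e1)
  obtain C1 a1 h1 where 1: "g1 = C1 \<circ> activation \<sigma> d a1 \<circ> h1" "a1 \<ge> 1"
      "C1 \<in> conv_layers d k a1 e1" "h1 \<in> cnns \<sigma> d k (Suc N) c a1"
    using 3 by auto
  obtain C2 a2 h2 where 2: "g2 = C2 \<circ> activation \<sigma> d a2 \<circ> h2" "a2 \<ge> 1"
      "C2 \<in> conv_layers d k a2 e2" "h2 \<in> cnns \<sigma> d k (Suc N) c a2"
    using 3 by auto
  obtain C where C: "C \<in> conv_layers d k (a1 + a2) (e1 + e2)"
    "\<And>y z. C (stack a1 y z) = stack e1 (C1 y) (C2 z)"
    using conv_layers_parallel[OF 1(3) 2(3)] by blast
  have "(\<lambda>x. stack a1 (h1 x) (h2 x)) \<in> cnns \<sigma> d k (Suc N) c (a1 + a2)"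
    using 3 1 2 by blast
  moreover have "(\<lambda>x. stack e1 (g1 x) (g2 x)) =
      C \<circ> activation \<sigma> d (a1 + a2) \<circ> (\<lambda>x. stack a1 (h1 x) (h2 x))"
    by (simp add: 1 2 C activation_stack fun_eq_iff)
  moreover have "a1 + a2 \<ge> 1" using 1(2) by simp
  ultimately show ?case unfolding cnns.simps using C(1) by blast
qed simp

text \<open>One output channel as a scalar function of input and position. Weight sharing is thereby
  built in: a single function serves all positions.\<close>

definition channels :: "(real \<Rightarrow> real) \<Rightarrow> nat \<Rightarrow> nat \<Rightarrow> nat \<Rightarrow> (tensor \<times> int \<Rightarrow> real) set" where
  "channels \<sigma> d n c = {\<lambda>(x, p). g x 1 p | g. g \<in> cnns \<sigma> d 1 n c 1}"

text \<open>The last layer absorbs the affine map. Its bias reaches only genuine positions, so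
  padding stays 0.\<close>

lemma channels_affine:
  assumes "h \<in> channels \<sigma> d n c"
  shows "(\<lambda>(x, p). if p \<in> {1..int d} then a * h (x, p) + b else 0) \<in> channels \<sigma> d n c"
proof -
  obtain g where g: "h = (\<lambda>(x, p). g x 1 p)" "g \<in> cnns \<sigma> d 1 n c 1"
    using assms by (auto simp: channels_def)
  from cnns_postcompose[OF g(2), of 1 "\<lambda>_ _. a" "\<lambda>_. b"] show ?thesis
    unfolding channels_def mem_Collect_eq
    by (intro exI conjI) (auto simp: g(1) mk_tensor_def fun_eq_iff)
qed

lemma channels_outside: "h \<in> channels \<sigma> d n c \<Longrightarrow> p \<notin> {1..int d} \<Longrightarrow> h (x, p) = 0"
proof -
  assume "h \<in> channels \<sigma> d n c" "p \<notin> {1..int d}"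
  then obtain g where g: "h = (\<lambda>(x, p). g x 1 p)" "g \<in> cnns \<sigma> d 1 n c 1" by (auto simp: channels_def)
  with cnns_tensors[OF g(2), of x] \<open>p \<notin> _\<close> show "h (x, p) = 0" by (auto simp: tensors_def)
qed

lemma channels_scale:
  assumes "h \<in> channels \<sigma> d n c"
  shows "(\<lambda>z. a * h z) \<in> channels \<sigma> d n c"
proof -
  have "a * h (x, p) = (if p \<in> {1..int d} then a * h (x, p) + 0 else 0)" for x p
    using channels_outside[OF assms, of p x] by auto
  then have "(\<lambda>z. a * h z) = (\<lambda>(x, p). if p \<in> {1..int d} then a * h (x, p) + 0 else 0)"
    by (intro ext) (simp only: split_paired_all prod.case)
  then show ?thesis
    by (rule ssubst[where P = "\<lambda>f. f \<in> channels \<sigma> d n c"]) (rule channels_affine[OF assms])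
qed

lemma channels_const:
  assumes "n \<ge> 1"
  shows "(\<lambda>(x, p). if p \<in> {1..int d} then b else 0) \<in> channels \<sigma> d n c"
proof -
  obtain g where "g \<in> cnns \<sigma> d 1 n c 1" using cnns_nonempty assms by blast
  then have "(\<lambda>(x, p). g x 1 p) \<in> channels \<sigma> d n c" by (auto simp: channels_def)
  from channels_affine[OF this, of 0 b] show ?thesis by (simp cong: if_cong)
qed

text \<open>The two networks are forked into one with two output channels, which the last layer
  sums.\<close>

lemma channels_add:
  assumes "h1 \<in> channels \<sigma> d n c" "h2 \<in> channels \<sigma> d n c"
  shows "(\<lambda>z. h1 z + h2 z) \<in> channels \<sigma> d n c"
proof -
  obtain g1 where g1: "h1 = (\<lambda>(x, p). g1 x 1 p)" "g1 \<in> cnns \<sigma> d 1 n c 1"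
    using assms by (auto simp: channels_def)
  obtain g2 where g2: "h2 = (\<lambda>(x, p). g2 x 1 p)" "g2 \<in> cnns \<sigma> d 1 n c 1"
    using assms by (auto simp: channels_def)
  have "(\<lambda>x. stack 1 (g1 x) (g2 x)) \<in> cnns \<sigma> d 1 n c (1 + 1)"
    using cnns_fork[OF g1(2) g2(2)] .
  from cnns_postcompose[OF this, of 1 "\<lambda>_ _. 1" "\<lambda>_. 0"]
  have "(\<lambda>x. mk_tensor 1 d (\<lambda>i m. \<Sum>l = 1..1 + 1. stack 1 (g1 x) (g2 x) l m)) \<in> cnns \<sigma> d 1 n c 1"
    by simp
  moreover have "(\<Sum>l = 1..1 + 1. stack 1 (g1 x) (g2 x) l m) = g1 x 1 m + g2 x 1 m" for x m
    unfolding sum_split_stack by (simp add: stack_def)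
  ultimately have *: "(\<lambda>x. mk_tensor 1 d (\<lambda>i m. g1 x 1 m + g2 x 1 m)) \<in> cnns \<sigma> d 1 n c 1"
    by (simp only:)
  have "(\<lambda>z. h1 z + h2 z) = (\<lambda>(x, p). mk_tensor 1 d (\<lambda>i m. g1 x 1 m + g2 x 1 m) 1 p)"
  proof (intro ext, clarify)
    fix x p
    show "h1 (x, p) + h2 (x, p) = mk_tensor 1 d (\<lambda>i m. g1 x 1 m + g2 x 1 m) 1 p"
    proof (cases "p \<in> {1..int d}")
      case False
      then show ?thesis
        using channels_outside[OF assms(1) False] channels_outside[OF assms(2) False]
        by (auto simp: mk_tensor_def)
    qed (simp add: g1 g2)
  qed
  then show ?thesis
    unfolding channels_def mem_Collect_eq using * by (intro exI conjI)
qed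

text \<open>One more layer with the unit kernel at \<open>s\<close>. Padding is applied after the
  activation, so a missing neighbour contributes 0 and not \<open>\<sigma> 0\<close>; this is how
  borders become visible.\<close>

lemma channels_step:
  assumes "h \<in> channels \<sigma> d n c" "n \<ge> 1" "s \<in> {-1..1}"
  shows "(\<lambda>(x, p). if p \<in> {1..int d} \<and> p - s \<in> {1..int d} then \<sigma> (h (x, p - s)) else 0)
    \<in> channels \<sigma> d (Suc n) c"
proof -
  obtain g where g: "h = (\<lambda>(x, p). g x 1 p)" "g \<in> cnns \<sigma> d 1 n c 1"
    using assms by (auto simp: channels_def)
  define C where "C x = mk_tensor 1 d
      (\<lambda>i m. (\<Sum>j = 1..1. conv 1 (\<lambda>l. if l = s then 1 else 0) (x j) m) + 0)" for x :: tensor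
  have "C \<in> conv_layers d 1 1 1"
    unfolding C_def[abs_def] conv_layers_def by fast
  then have "C \<circ> activation \<sigma> d 1 \<circ> g \<in> cnns \<sigma> d 1 (Suc n) c 1"
    using g(2) assms(2) by (cases n) auto
  moreover have "conv 1 (\<lambda>l. if l = s then 1 else 0) y m = y (m - s)" for y m
  proof -
    have "conv 1 (\<lambda>l. if l = s then 1 else 0) y m = (\<Sum>l = -1..1. if l = s then y (m - l) else 0)"
      unfolding conv_def by (intro sum.cong) auto
    then show ?thesis using assms(3) by simp
  qed
  ultimately show ?thesis
    unfolding channels_def mem_Collect_eq
    by (intro exI conjI) (auto simp: g(1) C_def activation_def mk_tensor_def fun_eq_iff)
qed

lemma channels_coordinate:
  assumes "i \<in> {1..c}" "s \<in> {-1..1}"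
  shows "(\<lambda>(x, p). if p \<in> {1..int d} then x i (p + s) else 0) \<in> channels \<sigma> d 1 c"
proof -
  \<comment> \<open>The kernel sits at \<open>- s\<close> because convolution reads position
    \<open>m - l\<close>.\<close>
  define C where "C x = mk_tensor 1 d
      (\<lambda>i' m. (\<Sum>j = 1..c. conv 1 (\<lambda>l. if j = i \<and> l = - s then 1 else 0) (x j) m) + 0)" for x :: tensor
  have "C \<in> conv_layers d 1 c 1"
    unfolding C_def[abs_def] conv_layers_def by fast
  then have "C \<in> cnns \<sigma> d 1 1 c 1" by simp
  moreover have "(\<Sum>j = 1..c. conv 1 (\<lambda>l. if j = i \<and> l = - s then 1 else 0) (x j) m) = x i (m + s)"
    for x :: tensor and m
  proof -
    have "conv 1 (\<lambda>l. if j = i \<and> l = - s then 1 else 0) (x j) m = (if j = i then x i (m + s) else 0)" for j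
    proof -
      have "conv 1 (\<lambda>l. if j = i \<and> l = - s then 1 else 0) (x j) m
          = (\<Sum>l = -1..1. if l = - s then if j = i then x i (m - l) else 0 else 0)"
        unfolding conv_def by (intro sum.cong) auto
      then show ?thesis using assms(2) by auto
    qed
    then show ?thesis using assms(1) by simp
  qed
  ultimately show ?thesis
    unfolding channels_def mem_Collect_eq
    by (intro exI conjI) (auto simp: C_def mk_tensor_def fun_eq_iff)
qed

lemma cnns_from_channels:
  assumes "c' \<ge> 1" "\<And>i. i \<in> {1..c'} \<Longrightarrow> h i \<in> channels \<sigma> d n c"
  shows "\<exists>g\<in>cnns \<sigma> d 1 n c c'. \<forall>x. \<forall>i\<in>{1..c'}. \<forall>p. g x i p = h i (x, p)"
  using assms
proof (induction c' rule: nat_induct_at_least)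
  case base
  then have "h 1 \<in> channels \<sigma> d n c" by simp
  then show ?case by (auto simp: channels_def)
next
  case (Suc e)
  then obtain g where g: "g \<in> cnns \<sigma> d 1 n c e" "\<forall>x. \<forall>i\<in>{1..e}. \<forall>p. g x i p = h i (x, p)"
    by auto
  have "h (Suc e) \<in> channels \<sigma> d n c" using Suc.prems by simp
  then obtain g' where g': "g' \<in> cnns \<sigma> d 1 n c 1" "h (Suc e) = (\<lambda>(x, p). g' x 1 p)"
    by (auto simp: channels_def)
  have "(\<lambda>x. stack e (g x) (g' x)) \<in> cnns \<sigma> d 1 n c (Suc e)"
    using cnns_fork[OF g(1) g'(1)] by simp
  moreover have "stack e (g x) (g' x) i p = h i (x, p)" if "i \<in> {1..Suc e}" for x i p
  proof (cases "i \<le> e")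
    case False
    with that have "i = Suc e" by auto
    then show ?thesis by (simp add: stack_def g'(2))
  qed (use g(2) that in \<open>auto simp: stack_def\<close>)
  ultimately show ?case by (intro bexI[of _ "\<lambda>x. stack e (g x) (g' x)"]) auto
qed

section \<open>Closures of network classes\<close>

lemma cnn_closure_iff:
  assumes K: "compactin (mtopology_of (tensor_metric c d)) K"
    and \<sigma>: "continuous_on UNIV \<sigma>"
  shows "f \<in> cnn_closure \<sigma> d k N c c' K \<longleftrightarrow> f \<in> mspace (C_metric c c' d K) \<and>
    (\<forall>e>0. \<exists>g\<in>cnns \<sigma> d k N c c'. \<forall>x\<in>K. \<forall>i\<in>{1..c'}. \<forall>m\<in>{1..int d}. \<bar>f x i m - g x i m\<bar> < e)"
    (is "_ \<longleftrightarrow> _ \<and> (\<forall>e>0. ?approx e)")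
proof -
  let ?M = "C_metric c c' d K"
  interpret Metric_space "mspace ?M" "mdist ?M" by (rule Metric_space_mspace_mdist)
  let ?X = "subtopology (mtopology_of (tensor_metric c d)) K"
  have top: "topspace ?X = K" by (rule topspace_C_metric_domain[OF K])
  have net: "restrict g K \<in> mspace ?M" if "g \<in> cnns \<sigma> d k N c c'" for g
    unfolding mspace_C_metric_iff[OF K]
    using cnns_continuous[OF \<sigma> that] cnns_tensors[OF that]
    by (auto simp: continuous_on_restrict intro: continuous_on_subset)
  have cl: "f \<in> cnn_closure \<sigma> d k N c c' K \<longleftrightarrow> f \<in> mspace ?M \<and>
      (\<forall>e>0. \<exists>g\<in>cnns \<sigma> d k N c c'. mdist ?M f (restrict g K) < e)"
    unfolding cnn_closure_def mtopology_of_def metric_closure_of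
    by (auto simp: in_mball net)
  have near: "mdist ?M f (restrict g K) < e \<Longrightarrow> \<forall>x\<in>K. \<forall>i\<in>{1..c'}. \<forall>m\<in>{1..int d}. \<bar>f x i m - g x i m\<bar> < e"
    if f: "f \<in> mspace ?M" and g: "g \<in> cnns \<sigma> d k N c c'" for g e
  proof
    fix x assume less: "mdist ?M f (restrict g K) < e" and x: "x \<in> K"
    have "tensor_dist c' d (f x) (g x) \<le> mdist ?M f (restrict g K)"
      using mdist_cfunspace_imp_mdist_le[of f ?X "tensor_metric c' d" "restrict g K" _ x] f net[OF g] x
      unfolding C_metric_def top by (simp del: mspace_cfunspace)
    with less have less': "tensor_dist c' d (f x) (g x) < e" by linarith
    moreover have "0 \<le> mdist ?M f (restrict g K)" by simp
    ultimately show "\<forall>i\<in>{1..c'}. \<forall>m\<in>{1..int d}. \<bar>f x i m - g x i m\<bar> < e"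
      using less by (subst tensor_dist_less_iff[symmetric]) linarith+
  qed
  \<comment> \<open>Entrywise strict bounds only give a weak bound on the supremum; halving
    \<open>e\<close> restores strictness.\<close>
  have far: "mdist ?M f (restrict g K) < e"
    if "e > 0" "\<forall>x\<in>K. \<forall>i\<in>{1..c'}. \<forall>m\<in>{1..int d}. \<bar>f x i m - g x i m\<bar> < e / 2" for g e
  proof -
    have "mdist ?M f (restrict g K) \<le> e / 2"
      unfolding C_metric_def
    proof (rule mdist_cfunspace_le)
      fix x assume "x \<in> topspace ?X"
      then have "x \<in> K" by (simp add: top)
      then show "mdist (tensor_metric c' d) (f x) (restrict g K x) \<le> e / 2"
        unfolding mdist_tensor_metric tensor_dist_le_iff using that by (auto intro: less_imp_le)
    qed (use that in simp)
    then show ?thesis using that(1) by simp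
  qed
  show ?thesis
  proof
    assume "f \<in> cnn_closure \<sigma> d k N c c' K"
    then show "f \<in> mspace ?M \<and> (\<forall>e>0. ?approx e)"
      unfolding cl using near by blast
  next
    assume R: "f \<in> mspace ?M \<and> (\<forall>e>0. ?approx e)"
    have "\<exists>g\<in>cnns \<sigma> d k N c c'. mdist ?M f (restrict g K) < e" if "e > 0" for e
    proof -
      have "?approx (e / 2)" using conjunct2[OF R] half_gt_zero[OF that] by blast
      then show ?thesis using far[OF that] by blast
    qed
    then show "f \<in> cnn_closure \<sigma> d k N c c' K" unfolding cl using R by blast
  qed
qed

section \<open>Lower bounds on the depth\<close>

text \<open>Finite sets are compact and every function on them is continuous, so a target that each
  network misses by \<open>e\<close> on a finite set refutes universality.\<close>

lemma not_universal_finite: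
  assumes \<sigma>: "continuous_on UNIV \<sigma>"
    and K: "finite K" "K \<subseteq> tensors c d"
    and F: "\<And>x. x \<in> K \<Longrightarrow> F x \<in> tensors c' d"
    and e: "e > 0"
    and far: "\<And>g. g \<in> cnns \<sigma> d k N c c' \<Longrightarrow> \<exists>x\<in>K. \<exists>i\<in>{1..c'}. \<exists>m\<in>{1..int d}. e \<le> \<bar>F x i m - g x i m\<bar>"
  shows "\<exists>K. compactin (mtopology_of (tensor_metric c d)) K \<and>
    \<not> mspace (C_metric c c' d K) \<subseteq> cnn_closure \<sigma> d k N c c' K"
proof (intro exI conjI)
  show comp: "compactin (mtopology_of (tensor_metric c d)) K"
    using K by (simp add: compactin_tensor_metric finite_imp_compact)
  have "restrict F K \<in> mspace (C_metric c c' d K)"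
    unfolding mspace_C_metric_iff[OF comp] using F K(1) by (auto simp: continuous_on_finite)
  moreover have "restrict F K \<notin> cnn_closure \<sigma> d k N c c' K"
  proof
    assume "restrict F K \<in> cnn_closure \<sigma> d k N c c' K"
    then obtain g where g: "g \<in> cnns \<sigma> d k N c c'"
      "\<forall>x\<in>K. \<forall>i\<in>{1..c'}. \<forall>m\<in>{1..int d}. \<bar>restrict F K x i m - g x i m\<bar> < e"
      unfolding cnn_closure_iff[OF comp \<sigma>] using e by blast
    from far[OF g(1)] obtain x i m where xim: "x \<in> K" "i \<in> {1..c'}" "m \<in> {1..int d}" "e \<le> \<bar>F x i m - g x i m\<bar>"
      by blast
    with g(2) have "\<bar>restrict F K x i m - g x i m\<bar> < e" by blast
    with xim show False by simp
  qed
  ultimately show "\<not> mspace (C_metric c c' d K) \<subseteq> cnn_closure \<sigma> d k N c c' K" by blast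
qed

section \<open>Targets missed by networks of smaller depth\<close>

definition unit_tensor :: "int \<Rightarrow> real \<Rightarrow> tensor" where
  "unit_tensor p v = (\<lambda>i m. if i = 1 \<and> m = p then v else 0)"

lemma unit_tensor_in_tensors: "c \<ge> 1 \<Longrightarrow> p \<in> {1..int d} \<Longrightarrow> unit_tensor p v \<in> tensors c d"
  by (auto simp: unit_tensor_def tensors_def)

lemma zero_in_tensors: "(\<lambda>_ _. 0) \<in> tensors c d"
  by (simp add: tensors_def)

lemma conv_scale: "conv k w (\<lambda>m. a * y m) m = a * conv k w y m"
  by (simp add: conv_def sum_distrib_left algebra_simps)

lemma conv_zero_input [simp]: "conv k w (\<lambda>_. 0) m = 0"
  by (simp add: conv_def)

text \<open>A single layer is affine in its input while the target contains an absolute value; three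
  collinear inputs reveal the difference.\<close>

lemma not_universal_depth_1:
  assumes \<sigma>: "continuous_on UNIV \<sigma>" and dc: "d \<ge> 1" "c \<ge> 1" "c' \<ge> 1"
  shows "\<exists>K. compactin (mtopology_of (tensor_metric c d)) K \<and>
    \<not> mspace (C_metric c c' d K) \<subseteq> cnn_closure \<sigma> d k 1 c c' K"
proof (rule not_universal_finite[OF \<sigma>])
  let ?e = "unit_tensor 1"
  let ?K = "{?e 1, ?e (-1), \<lambda>_ _. 0}"
  let ?F = "\<lambda>x :: tensor. ?e \<bar>x 1 1\<bar>"
  show "finite ?K" by simp
  show "?K \<subseteq> tensors c d"
    using dc unit_tensor_in_tensors[of c 1 d] zero_in_tensors by simp
  show "?F x \<in> tensors c' d" for x
    using dc by (intro unit_tensor_in_tensors) auto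
  show "(1/4 :: real) > 0" by simp
  fix g assume "g \<in> cnns \<sigma> d k 1 c c'"
  then obtain w \<delta> where g: "g = (\<lambda>x. mk_tensor c' d (\<lambda>i m. (\<Sum>j = 1..c. conv k (w i j) (x j) m) + \<delta> i))"
    by (auto simp: conv_layers_def)
  define L where "L x = (\<Sum>j = 1..c. conv k (w 1 j) (x j) 1)" for x :: tensor
  have gL: "g x 1 1 = L x + \<delta> 1" for x using dc by (simp add: g L_def)
  have "L (?e v) = v * L (?e 1)" for v
  proof -
    have "?e v j = (\<lambda>m. v * ?e 1 j m)" for j by (auto simp: unit_tensor_def)
    then show ?thesis by (simp add: L_def conv_scale sum_distrib_left)
  qed
  from this[of "-1"] have neg: "L (?e (-1)) = - L (?e 1)" by simp
  have zero: "L (\<lambda>_ _. 0) = 0" by (simp add: L_def)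
  show "\<exists>x\<in>?K. \<exists>i\<in>{1..c'}. \<exists>m\<in>{1..int d}. 1/4 \<le> \<bar>?F x i m - g x i m\<bar>"
  proof (rule ccontr)
    assume "\<not> ?thesis"
    then have "\<bar>?F x 1 1 - g x 1 1\<bar> < 1/4" if "x \<in> ?K" for x
      using that dc by (auto simp: not_le)
    then have near: "\<bar>?F x 1 1 - (L x + \<delta> 1)\<bar> < 1/4" if "x \<in> ?K" for x
      using that unfolding gL by blast
    have unit: "unit_tensor p v 1 p = v" for p v by (simp add: unit_tensor_def)
    \<comment> \<open>Averaging the first two bounds puts \<open>\<delta> 1\<close> within 1/4 of 1;
      the third puts it within 1/4 of 0.\<close>
    have "\<bar>1 - (L (?e 1) + \<delta> 1)\<bar> < 1/4" "\<bar>1 - (- L (?e 1) + \<delta> 1)\<bar> < 1/4" "\<bar>0 - (0 + \<delta> 1)\<bar> < 1/4"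
      using near[of "?e 1"] near[of "?e (-1)"] near[of "\<lambda>_ _. 0"] unfolding neg zero unit by auto
    then show False by linarith
  qed
qed

lemma conv_1: "conv 1 w y m = w (-1) * y (m + 1) + w 0 * y m + w 1 * y (m - 1)"
proof -
  have "{- int 1..int 1} = {-1, 0, 1}" by auto
  then show ?thesis by (simp add: conv_def)
qed

text \<open>Each layer extends the dependence by one position. Only the right end of the window is
  tracked.\<close>

lemma cnns_receptive_field:
  assumes "g \<in> cnns \<sigma> d 1 n c c'" "\<And>i m. m \<le> p + int n \<Longrightarrow> x i m = y i m"
  shows "g x i p = g y i p"
  using assms
proof (induction n arbitrary: g c' i p)
  case (Suc n)
  have layer: "C x' i p = C y' i p"
    if C: "C \<in> conv_layers d 1 c1 c2" and "\<And>j m. m \<le> p + 1 \<Longrightarrow> x' j m = y' j m" for C c1 c2 x' y' i p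
  proof -
    obtain w \<delta> where C': "C = (\<lambda>x. mk_tensor c2 d (\<lambda>i m. (\<Sum>j = 1..c1. conv 1 (w i j) (x j) m) + \<delta> i))"
      using C by (auto simp: conv_layers_def)
    show ?thesis unfolding C' conv_1 mk_tensor_def using that(2) by auto
  qed
  show ?case
  proof (cases n)
    case 0
    then show ?thesis using Suc.prems layer by simp
  next
    case (Suc n')
    then obtain C e h where g: "g = C \<circ> activation \<sigma> d e \<circ> h" "C \<in> conv_layers d 1 e c'" "h \<in> cnns \<sigma> d 1 n c e"
      using Suc.prems(1) by auto
    have "h x j m = h y j m" if "m \<le> p + 1" for j m
      using that Suc.prems(2) by (intro Suc.IH[OF g(3)]) auto
    then show ?thesis unfolding g(1) comp_def
      by (intro layer[OF g(2)]) (auto simp: activation_def mk_tensor_def)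
  qed
qed simp

text \<open>Position 1 sees inputs up to \<open>n + 1 < d\<close>, but the target copies the last
  input there: it takes the values 1 and 0 where the network output is the same.\<close>

lemma not_universal_receptive_field:
  assumes \<sigma>: "continuous_on UNIV \<sigma>" and dc: "n + 1 < d" "c \<ge> 1" "c' \<ge> 1"
  shows "\<exists>K. compactin (mtopology_of (tensor_metric c d)) K \<and>
    \<not> mspace (C_metric c c' d K) \<subseteq> cnn_closure \<sigma> d 1 n c c' K"
proof (rule not_universal_finite[OF \<sigma>])
  let ?e = "unit_tensor (int d) 1"
  let ?K = "{?e, \<lambda>_ _. 0}"
  let ?F = "\<lambda>x :: tensor. unit_tensor 1 (x 1 (int d))"
  show "finite ?K" by simp
  show "?K \<subseteq> tensors c d"
    using dc unit_tensor_in_tensors[of c "int d" d] zero_in_tensors by simp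
  show "?F x \<in> tensors c' d" for x
    using dc by (intro unit_tensor_in_tensors) auto
  show "(1/2 :: real) > 0" by simp
  fix g assume g: "g \<in> cnns \<sigma> d 1 n c c'"
  have eq: "g ?e 1 1 = g (\<lambda>_ _. 0) 1 1"
    using dc by (intro cnns_receptive_field[OF g]) (auto simp: unit_tensor_def)
  show "\<exists>x\<in>?K. \<exists>i\<in>{1..c'}. \<exists>m\<in>{1..int d}. 1/2 \<le> \<bar>?F x i m - g x i m\<bar>"
  proof (rule ccontr)
    assume "\<not> ?thesis"
    then have "\<bar>?F x 1 1 - g x 1 1\<bar> < 1/2" if "x \<in> ?K" for x
      using that dc by (auto simp: not_le)
    from this[of "?e"] this[of "\<lambda>_ _. 0"] show False
      unfolding eq by (simp add: unit_tensor_def)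
  qed
qed

text \<open>For \<open>d = 3\<close> a network of depth 2 sees every input, but its weights are shared: translating
  both the input and the output by one position does not change the response.\<close>

lemma cnns_depth_2_translation:
  assumes "g \<in> cnns \<sigma> 3 1 2 c c'"
  shows "g (unit_tensor 1 1) i 2 - g (\<lambda>_ _. 0) i 2 = g (unit_tensor 2 1) i 3 - g (\<lambda>_ _. 0) i 3"
proof -
  obtain C e C1 where g: "g = C \<circ> activation \<sigma> 3 e \<circ> C1" "C \<in> conv_layers 3 1 e c'" "C1 \<in> conv_layers 3 1 c e"
    using assms by (auto simp: numeral_2_eq_2)
  obtain w \<delta> where C: "C = (\<lambda>x. mk_tensor c' 3 (\<lambda>i m. (\<Sum>j = 1..e. conv 1 (w i j) (x j) m) + \<delta> i))"
    using g(2) by (auto simp: conv_layers_def)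
  obtain w1 \<delta>1 where C1: "C1 = (\<lambda>x. mk_tensor e 3 (\<lambda>i m. (\<Sum>j = 1..c. conv 1 (w1 i j) (x j) m) + \<delta>1 i))"
    using g(3) by (auto simp: conv_layers_def)
  define h where "h x = activation \<sigma> 3 e (C1 x)" for x
  let ?z = "\<lambda>_ _. 0" and ?a = "unit_tensor 1 1" and ?b = "unit_tensor 2 1"
  \<comment> \<open>Right neighbours cancel in both differences: a unit at 1 leaves hidden position
    3 as for zero input, and hidden position 4 is padding. The other two hidden positions are
    translates of each other.\<close>
  have h: "h ?a j 3 = h ?z j 3" "h ?a j 2 = h ?b j 3" "h ?a j 1 = h ?b j 2"
    "h ?z j 2 = h ?z j 3" "h ?z j 1 = h ?z j 2" "h x j 4 = 0" for j x
    unfolding h_def activation_def C1 mk_tensor_def conv_1 unit_tensor_def by auto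
  have gh: "g x i m = (if i \<in> {1..c'} then (\<Sum>j = 1..e. conv 1 (w i j) (h x j) m) + \<delta> i else 0)"
    if "m \<in> {1..3}" for x m
    using that by (simp add: g(1) h_def C mk_tensor_def)
  have "conv 1 (w i j) (h ?a j) 2 - conv 1 (w i j) (h ?z j) 2
      = conv 1 (w i j) (h ?b j) 3 - conv 1 (w i j) (h ?z j) 3" for j
    unfolding conv_1 using h(1-5)[of j] h(6)[of _ j] by simp
  then have "(\<Sum>j = 1..e. conv 1 (w i j) (h ?a j) 2) - (\<Sum>j = 1..e. conv 1 (w i j) (h ?z j) 2)
      = (\<Sum>j = 1..e. conv 1 (w i j) (h ?b j) 3) - (\<Sum>j = 1..e. conv 1 (w i j) (h ?z j) 3)"
    unfolding sum_subtractf[symmetric] by (intro sum.cong) auto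
  then show ?thesis by (simp add: gh)
qed

text \<open>The target asks for response 1 at position 2 to a unit at 1, but response 0 at position
  3 to a unit at 2. \<open>cnns_depth_2_translation\<close> equates these responses, and four errors
  below 1/4 cannot bridge a gap of 1.\<close>

lemma not_universal_3:
  assumes \<sigma>: "continuous_on UNIV \<sigma>" and c: "c \<ge> 1" "c' \<ge> 1"
  shows "\<exists>K. compactin (mtopology_of (tensor_metric c 3)) K \<and>
    \<not> mspace (C_metric c c' 3 K) \<subseteq> cnn_closure \<sigma> 3 1 2 c c' K"
proof (rule not_universal_finite[OF \<sigma>])
  let ?K = "{unit_tensor 1 1, unit_tensor 2 1, \<lambda>_ _. 0}"
  let ?F = "\<lambda>x :: tensor. unit_tensor 2 (x 1 1)"
  show "finite ?K" by simp
  show "?K \<subseteq> tensors c 3"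
    using c unit_tensor_in_tensors[of c _ 3] zero_in_tensors by simp
  show "?F x \<in> tensors c' 3" for x
    using c by (intro unit_tensor_in_tensors) auto
  show "(1/4 :: real) > 0" by simp
  fix g assume g: "g \<in> cnns \<sigma> 3 1 2 c c'"
  show "\<exists>x\<in>?K. \<exists>i\<in>{1..c'}. \<exists>m\<in>{1..int 3}. 1/4 \<le> \<bar>?F x i m - g x i m\<bar>"
  proof (rule ccontr)
    assume "\<not> ?thesis"
    then have "\<bar>?F x 1 m - g x 1 m\<bar> < 1/4" if "x \<in> ?K" "m \<in> {1..3}" for x m
      using that c by (auto simp: not_le)
    from this[of "unit_tensor 1 1" 2] this[of "unit_tensor 2 1" 3] this[of "\<lambda>_ _. 0" 2]
      this[of "\<lambda>_ _. 0" 3] cnns_depth_2_translation[OF g, of 1] show False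
      by (simp add: unit_tensor_def)
  qed
qed

lemma depth_lower_bound:
  assumes "continuous_on UNIV \<sigma>" "d \<ge> 1" "c \<ge> 1" "c' \<ge> 1"
  shows "\<exists>K. compactin (mtopology_of (tensor_metric c d)) K \<and>
    \<not> mspace (C_metric c c' d K) \<subseteq> cnn_closure \<sigma> d 1 (uap_depth d - 1) c c' K"
proof -
  consider "d \<le> 2" | "d = 3" | "d \<ge> 4" by linarith
  then show ?thesis
  proof cases
    case 1
    then show ?thesis using not_universal_depth_1[OF assms, of 1] by (simp add: uap_depth_def)
  next
    case 2
    then show ?thesis using not_universal_3[OF assms(1,3,4)] by (simp add: uap_depth_def)
  next
    case 3
    then show ?thesis
      using not_universal_receptive_field[OF assms(1) _ assms(3,4), of "d - 2" d]
      by (simp add: uap_depth_def numeral_2_eq_2)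
  qed
qed

section \<open>Universality\<close>

text \<open>A continuous map from a compact set into a Hausdorff space is closed, hence a quotient
  map onto its image.\<close>

lemma continuous_on_compact_quotient:
  fixes \<phi> :: "'a::t2_space \<Rightarrow> 'b::t2_space" and g :: "'b \<Rightarrow> 'c::topological_space"
  assumes K: "compact K" and \<phi>: "continuous_on K \<phi>" and g: "continuous_on K (\<lambda>x. g (\<phi> x))"
  shows "continuous_on (\<phi> ` K) g"
proof -
  have "closed (\<phi> ` K)" using K \<phi> compact_continuous_image compact_imp_closed by blast
  moreover have "closed (g -` B \<inter> \<phi> ` K)" if "closed B" for B
  proof -
    have "closed ((\<lambda>x. g (\<phi> x)) -` B \<inter> K)"
      using g that compact_imp_closed[OF K] by (simp add: continuous_on_closed_vimage)
    then have "compact ((\<lambda>x. g (\<phi> x)) -` B \<inter> K)"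
      using K by (metis compact_Int_closed inf_assoc inf_commute inf_idem)
    then have "compact (\<phi> ` ((\<lambda>x. g (\<phi> x)) -` B \<inter> K))"
      using \<phi> by (intro compact_continuous_image) (auto intro: continuous_on_subset)
    moreover have "\<phi> ` ((\<lambda>x. g (\<phi> x)) -` B \<inter> K) = g -` B \<inter> \<phi> ` K" by auto
    ultimately show ?thesis by (metis compact_imp_closed)
  qed
  ultimately show ?thesis by (simp add: continuous_on_closed_vimage)
qed

text \<open>Everything that position \<open>p\<close> can see after \<open>n\<close> layers: the window of radius \<open>n\<close> and, in
  the unused channel 0, the zero padding inside the window of radius \<open>n - 1\<close>.\<close>

definition view :: "nat \<Rightarrow> nat \<Rightarrow> tensor \<times> int \<Rightarrow> tensor" where
  "view d n = (\<lambda>(x, p) i j.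
     if i = 0 then if \<bar>j\<bar> < int n \<and> p + j \<in> {1..int d} then 1 else 0
     else if \<bar>j\<bar> \<le> int n then x i (p + j) else 0)"

text \<open>This is the form in which one more layer computes the wider window: a nonzero offset is
  read through the neighbour in its direction, offset 0 in place since \<open>sgn 0 = 0\<close>.
  Beyond a neighbour that is padding there is only padding.\<close>

lemma view_Suc:
  assumes "x \<in> tensors c d" "p \<in> {1..int d}" "n \<ge> 1"
  shows "view d (Suc n) (x, p) i j =
    (if p + sgn j \<in> {1..int d} then view d n (x, p + sgn j) i (j - sgn j) else 0)"
proof -
  have x: "x i m = 0" if "m \<notin> {1..int d}" for m
    using assms(1) that by (auto simp: tensors_def)
  consider "j > 0" | "j = 0" | "j < 0" by linarith
  then show ?thesis
  proof cases
    case 1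
    then show ?thesis using assms(2,3) x[of "p + j"] by (auto simp: view_def)
  next
    case 2
    then show ?thesis using assms(2,3) by (auto simp: view_def)
  next
    case 3
    then show ?thesis using assms(2,3) x[of "p + j"] by (auto simp: view_def)
  qed
qed

lemma view_eq_positions:
  assumes "view d n (x, p) = view d n (y, q)" "p \<in> {1..int d}" "q \<in> {1..int d}" "p < q"
  shows "int n \<le> p" "q \<le> int d + 1 - int n"
proof -
  have pad: "view d n (x, p) 0 j = view d n (y, q) 0 j" for j using assms(1) by simp
  \<comment> \<open>Offset \<open>- p\<close> leads from \<open>p\<close> to padding but from
    \<open>q\<close> to a genuine position. On the right, \<open>int d + 1 - q\<close> does the same
    with the roles exchanged.\<close>
  show "int n \<le> p" using pad[of "- p"] assms(2-) by (auto simp: view_def split: if_splits)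
  show "q \<le> int d + 1 - int n"
    using pad[of "int d + 1 - q"] assms(2-) by (auto simp: view_def split: if_splits)
qed

lemma view_eq_entry:
  assumes "view d n (x, p) = view d n (y, q)" "i \<ge> 1" "\<bar>m - p\<bar> \<le> int n"
  shows "x i m = y i (m + (q - p))"
proof -
  have "view d n (x, p) i (m - p) = view d n (y, q) i (m - p)" using assms(1) by simp
  then show ?thesis using assms(2,3) by (simp add: view_def algebra_simps)
qed

lemma tensors_eqI:
  assumes "x \<in> tensors c d" "y \<in> tensors c d"
    and "\<And>i m. i \<ge> 1 \<Longrightarrow> m \<in> {1..int d} \<Longrightarrow> x i m = y i m"
  shows "x = y"
proof (intro ext)
  fix i m
  show "x i m = y i m"
    using assms by (cases "i \<ge> 1 \<and> m \<in> {1..int d}") (auto simp: tensors_def)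
qed

text \<open>The last two assumptions make the window around \<open>p\<close> cover
  \<open>{1..int d}\<close>.\<close>

lemma view_eq_same_position:
  assumes "view d n (x, p) = view d n (y, p)" "x \<in> tensors c d" "y \<in> tensors c d"
    and "p - 1 \<le> int n" "int d - p \<le> int n"
  shows "x = y"
  by (rule tensors_eqI[OF assms(2,3)]) (use view_eq_entry[OF assms(1)] assms(4,5) in force)

section \<open>Closed spans of channels over a compact domain\<close>

locale cnn_domain =
  fixes \<sigma> :: "real \<Rightarrow> real" and d c :: nat and K :: "tensor set"
  assumes continuous_activation: "continuous_on UNIV \<sigma>"
    and nonpolynomial: "\<not> (\<exists>p. \<forall>t. \<sigma> t = poly p t)"
    and compact_domain: "compact K"
    and domain_tensors: "K \<subseteq> tensors c d"
    and positive_dimension: "d \<ge> 1"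
begin

abbreviation points :: "(tensor \<times> int) set" where
  "points \<equiv> K \<times> {1..int d}"

text \<open>\<open>reach n\<close> models outputs of \<open>n\<close> layers before activation,
  \<open>activated n\<close> what the next layer can combine linearly.\<close>

abbreviation reach :: "nat \<Rightarrow> (tensor \<times> int \<Rightarrow> real) set" where
  "reach n \<equiv> uspan points (channels \<sigma> d n c)"

abbreviation activated :: "nat \<Rightarrow> (tensor \<times> int \<Rightarrow> real) set" where
  "activated n \<equiv> uspan points {\<lambda>z. \<sigma> (h z) | h. h \<in> channels \<sigma> d n c}"

lemma reach_approx:
  assumes "f \<in> reach n" "n \<ge> 1" "e > 0"
  shows "\<exists>h\<in>channels \<sigma> d n c. \<forall>z\<in>points. \<bar>f z - h z\<bar> < e"
proof (rule uspan_approx[OF assms(1,3)])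
  show "(\<lambda>_. 0) \<in> channels \<sigma> d n c"
    using channels_const[OF assms(2), of d 0 \<sigma> c] by (simp add: case_prod_unfold)
qed (simp_all add: channels_add channels_scale)

text \<open>Approximate \<open>f\<close> by a channel \<open>h\<close> and \<open>exp\<close> by
  combinations of \<open>\<sigma> (a * t + b)\<close>, whose affine maps \<open>h\<close> absorbs.
  The exponential serves to turn sums before activation into products after it.\<close>

lemma exp_activated:
  assumes f: "f \<in> reach n" and n: "n \<ge> 1" and M: "\<And>z. z \<in> points \<Longrightarrow> \<bar>f z\<bar> \<le> M"
  shows "(\<lambda>z. exp (f z)) \<in> activated n"
proof (rule uspan.lim)
  fix e :: real assume "e > 0"
  \<comment> \<open>The interval is widened by 1 so that it contains the values of a channel within
    distance 1 of \<open>f\<close>.\<close>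
  have exp: "exp \<in> uspan {-(M + 1)..M + 1} {\<lambda>t. \<sigma> (a * t + b) | a b. True}"
    by (intro ridge_universal continuous_activation nonpolynomial continuous_intros)
  have "continuous_on UNIV (exp :: real \<Rightarrow> real)" by (intro continuous_intros)
  from uniform_modulus[OF this \<open>e > 0\<close>, of "M + 1"] obtain \<delta> where \<delta>: "\<delta> > 0"
    "\<And>u v. \<bar>u\<bar> \<le> M + 1 \<Longrightarrow> \<bar>v\<bar> \<le> M + 1 \<Longrightarrow> \<bar>u - v\<bar> < \<delta> \<Longrightarrow> \<bar>exp u - exp v\<bar> < e"
    by blast
  obtain h where h: "h \<in> channels \<sigma> d n c" "\<forall>z\<in>points. \<bar>f z - h z\<bar> < min \<delta> 1"
    using reach_approx[OF f n, of "min \<delta> 1"] \<delta>(1) by auto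
  have hM: "\<bar>h z\<bar> \<le> M + 1" if "z \<in> points" for z
    using M[OF that] h(2)[rule_format, OF that] by linarith
  have "(\<lambda>z. exp (h z)) \<in> activated n"
  proof (rule uspan_comp[OF exp])
    fix z assume "z \<in> points"
    then show "h z \<in> {-(M + 1)..M + 1}" using hM[of z] by (simp add: abs_le_iff)
  next
    fix \<psi> assume "\<psi> \<in> {\<lambda>t. \<sigma> (a * t + b) | a b. True}"
    then obtain a b where \<psi>: "\<psi> = (\<lambda>t. \<sigma> (a * t + b))" by blast
    let ?h' = "\<lambda>(x, p). if p \<in> {1..int d} then a * h (x, p) + b else 0"
    have "(\<lambda>z. \<sigma> (?h' z)) \<in> activated n"
      using channels_affine[OF h(1), of a b] by (intro uspan.base) blast
    then show "(\<lambda>z. \<psi> (h z)) \<in> activated n"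
      by (rule uspan_cong) (auto simp: \<psi>)
  qed
  moreover have "\<bar>exp (f z) - exp (h z)\<bar> < e" if "z \<in> points" for z
    using \<delta>(2)[of "f z" "h z"] hM[OF that] M[OF that] h(2)[rule_format, OF that] by linarith
  ultimately show "\<exists>g. g \<in> activated n \<and> (\<forall>z\<in>points. \<bar>exp (f z) - g z\<bar> < e)" by blast
qed

lemma continuous_view: "continuous_on K (\<lambda>x. view d n (x, p))"
proof (intro continuous_on_coordinatewise_then_product)
  fix i j
  show "continuous_on K (\<lambda>x. view d n (x, p) i j)"
    by (cases "i = 0"; cases "\<bar>j\<bar> \<le> int n") (auto simp: view_def intro!: continuous_intros)
qed

text \<open>On the compact set of views the functions \<open>exp (l u)\<close> with \<open>l\<close>
  in the linear space \<open>Lin\<close> form a multiplicative set. It separates views because every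
  entry is in \<open>Lin\<close>, so Stone--Weierstrass yields all continuous functions of the
  view.\<close>

lemma activated_factor:
  assumes L: "\<And>i j. (\<lambda>z. view d n z i j) \<in> reach n" and n: "n \<ge> 1"
    and F: "\<And>p. p \<in> {1..int d} \<Longrightarrow> continuous_on K (\<lambda>x. F (x, p))"
    and factor: "\<And>z z'. z \<in> points \<Longrightarrow> z' \<in> points \<Longrightarrow> view d n z = view d n z' \<Longrightarrow> F z = F z'"
  shows "F \<in> activated n"
proof -
  \<comment> \<open>There are finitely many positions, so the set of views is a finite union of
    compact slices.\<close>
  define S where "S = (\<Union>p\<in>{1..int d}. (\<lambda>x. view d n (x, p)) ` K)"
  have viewS: "view d n z \<in> S" if "z \<in> points" for z using that by (auto simp: S_def)
  have compact_slice: "compact ((\<lambda>x. view d n (x, p)) ` K)" for p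
    by (intro compact_continuous_image continuous_view compact_domain)
  then have S: "compact S" unfolding S_def by (intro compact_UN) auto
  define g where "g u = F (SOME z. z \<in> points \<and> view d n z = u)" for u
  have g: "g (view d n z) = F z" if "z \<in> points" for z
  proof -
    define z' where "z' = (SOME z'. z' \<in> points \<and> view d n z' = view d n z)"
    have "z' \<in> points \<and> view d n z' = view d n z"
      unfolding z'_def by (rule someI[of _ z]) (use that in simp)
    then have "F z' = F z" using factor that by blast
    then show ?thesis by (simp add: g_def z'_def)
  qed
  \<comment> \<open>Continuity descends along the quotient map of each slice and is glued over
    finitely many closed slices.\<close>
  have gc: "continuous_on S g"
    unfolding S_def
  proof (rule continuous_on_closed_Union)
    fix p assume p: "p \<in> {1..int d}"
    show "closed ((\<lambda>x. view d n (x, p)) ` K)" by (rule compact_imp_closed[OF compact_slice])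
    have "continuous_on K (\<lambda>x. g (view d n (x, p)))"
      using F[OF p] by (rule continuous_on_eq) (use p g in auto)
    then show "continuous_on ((\<lambda>x. view d n (x, p)) ` K) g"
      by (intro continuous_on_compact_quotient compact_domain continuous_view)
  qed simp
  define Lin where "Lin = {l. continuous_on S l \<and> (\<lambda>z. l (view d n z)) \<in> reach n}"
  have "g \<in> uspan S {\<lambda>u. exp (l u) | l. l \<in> Lin}"
  proof (rule uspan_Stone_Weierstrass[OF S])
    show "continuous_on S b" if "b \<in> {\<lambda>u. exp (l u) | l. l \<in> Lin}" for b
      using that by (auto simp: Lin_def intro!: continuous_intros)
    have "(\<lambda>_. 0) \<in> Lin" by (simp add: Lin_def uspan.zero)
    then show "(\<lambda>_. 1) \<in> {\<lambda>u. exp (l u :: real) | l. l \<in> Lin}"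
      unfolding mem_Collect_eq by (intro exI[of _ "\<lambda>_. 0"]) auto
    show "(\<lambda>u. b u * b' u) \<in> {\<lambda>u. exp (l u) | l. l \<in> Lin}"
      if "b \<in> {\<lambda>u. exp (l u) | l. l \<in> Lin}" "b' \<in> {\<lambda>u. exp (l u) | l. l \<in> Lin}" for b b'
    proof -
      obtain l where l: "b = (\<lambda>u. exp (l u))" "l \<in> Lin" using \<open>b \<in> _\<close> by blast
      obtain l' where l': "b' = (\<lambda>u. exp (l' u))" "l' \<in> Lin" using \<open>b' \<in> _\<close> by blast
      have "(\<lambda>u. l u + l' u) \<in> Lin"
        using l(2) l'(2) by (auto simp: Lin_def intro!: continuous_intros uspan.add)
      then show ?thesis
        unfolding mem_Collect_eq by (intro exI[of _ "\<lambda>u. l u + l' u"]) (auto simp: l l' exp_add)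
    qed
    show "\<exists>b\<in>{\<lambda>u. exp (l u) | l. l \<in> Lin}. b u \<noteq> b v" if uv: "u \<noteq> v" for u v
    proof -
      obtain i j where ij: "u i j \<noteq> v i j" using uv by (metis ext)
      have "(\<lambda>u. u i j) \<in> Lin" unfolding Lin_def using L by (auto intro!: continuous_intros)
      then have "(\<lambda>u. exp (u i j)) \<in> {\<lambda>u. exp (l u) | l. l \<in> Lin}"
        unfolding mem_Collect_eq by (intro exI[of _ "\<lambda>u. u i j"] conjI refl)
      then show ?thesis using ij by (intro bexI[of _ "\<lambda>u. exp (u i j)"]) auto
    qed
  qed (rule gc)
  then have "(\<lambda>z. g (view d n z)) \<in> activated n"
  proof (rule uspan_comp)
    fix b assume "b \<in> {\<lambda>u. exp (l u) | l. l \<in> Lin}"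
    then obtain l where l: "b = (\<lambda>u. exp (l u))" "continuous_on S l" "(\<lambda>z. l (view d n z)) \<in> reach n"
      by (auto simp: Lin_def)
    have "bounded (l ` S)" by (intro compact_imp_bounded compact_continuous_image l S)
    then obtain M where "\<And>u. u \<in> S \<Longrightarrow> \<bar>l u\<bar> \<le> M"
      unfolding bounded_iff by (metis imageI real_norm_def)
    then show "(\<lambda>z. b (view d n z)) \<in> activated n"
      unfolding l(1) using viewS by (intro exp_activated[OF l(3) n]) auto
  qed (rule viewS)
  then show ?thesis by (rule uspan_cong) (simp add: g)
qed

text \<open>A unit kernel in the next layer moves every generator by \<open>s\<close>; the weight
  \<open>\<phi>\<close> cuts off positions whose source is padding.\<close>

lemma reach_shift:
  assumes F: "F \<in> activated n" and n: "n \<ge> 1" and s: "s \<in> {-1..1}"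
  shows "(\<lambda>(x, p). if p - s \<in> {1..int d} then F (x, p - s) else 0) \<in> reach (Suc n)"
proof -
  define \<phi> :: "tensor \<times> int \<Rightarrow> real" where "\<phi> z = (if snd z - s \<in> {1..int d} then 1 else 0)" for z
  define \<tau> :: "tensor \<times> int \<Rightarrow> tensor \<times> int" where "\<tau> z = (fst z, snd z - s)" for z
  have "(\<lambda>z. \<phi> z * F (\<tau> z)) \<in> reach (Suc n)"
  proof (rule uspan_weighted_comp[OF F])
    fix b assume "b \<in> {\<lambda>z. \<sigma> (h z) | h. h \<in> channels \<sigma> d n c}"
    then obtain h where h: "b = (\<lambda>z. \<sigma> (h z))" "h \<in> channels \<sigma> d n c" by blast
    show "(\<lambda>z. \<phi> z * b (\<tau> z)) \<in> reach (Suc n)"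
      by (rule uspan_cong[OF uspan.base[OF channels_step[OF h(2) n s]]])
        (auto simp: \<phi>_def \<tau>_def h(1))
  qed (auto simp: \<phi>_def \<tau>_def split: if_splits)
  then show ?thesis by (rule uspan_cong) (auto simp: \<phi>_def \<tau>_def)
qed

text \<open>Induction on depth: an entry of the current view survives the activation by
  \<open>activated_factor\<close>, the next layer moves it to a neighbour, and
  \<open>view_Suc\<close> recognizes the wider view.\<close>

lemma view_reach:
  assumes "n \<ge> 1"
  shows "(\<lambda>z. view d n z i j) \<in> reach n"
  using assms
proof (induction n arbitrary: i j rule: nat_induct_at_least)
  case base
  have x: "x i (p + j) = 0" if "x \<in> K" "i \<notin> {1..c}" for x p
    using that domain_tensors by (auto simp: tensors_def)
  consider "i = 0" "j = 0" | "i \<in> {1..c}" "j \<in> {-1..1}"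
    | "i = 0" "j \<noteq> 0" | "i \<noteq> 0" "i \<notin> {1..c} \<or> j \<notin> {-1..1}" by force
  then show ?case
  proof cases
    case 1
    show ?thesis
      by (rule uspan_cong[OF uspan.base[OF channels_const[OF order.refl, of d 1]]])
        (auto simp: 1 view_def)
  next
    case 2
    show ?thesis
      by (rule uspan_cong[OF uspan.base[OF channels_coordinate[OF 2]]])
        (use 2 in \<open>auto simp: view_def\<close>)
  next
    case 3
    show ?thesis by (rule uspan_cong[OF uspan.zero]) (use 3 in \<open>auto simp: view_def\<close>)
  next
    case 4
    show ?thesis by (rule uspan_cong[OF uspan.zero]) (use 4 x in \<open>auto simp: view_def\<close>)
  qed
next
  case (Suc n)
  have "(\<lambda>z. view d n z i (j - sgn j)) \<in> activated n"
    using Suc by (intro activated_factor)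
      (auto intro!: continuous_on_product_then_coordinatewise[OF continuous_on_product_then_coordinatewise[OF continuous_view]])
  moreover have "- sgn j \<in> {-1..1}" by (auto simp: sgn_if)
  ultimately have "(\<lambda>(x, p). if p - - sgn j \<in> {1..int d} then view d n (x, p - - sgn j) i (j - sgn j) else 0) \<in> reach (Suc n)"
    using reach_shift Suc.hyps by blast
  then
  have "(\<lambda>(x, p). if p + sgn j \<in> {1..int d} then view d n (x, p + sgn j) i (j - sgn j) else 0) \<in> reach (Suc n)"
    by (simp only: diff_minus_eq_add)
  then show ?case
    by (rule uspan_cong) (use view_Suc[OF _ _ Suc.hyps] domain_tensors in auto)
qed

lemma reach_factor:
  assumes "n \<ge> 1" "s \<in> {-1..1}"
    and "\<And>p. p \<in> {1..int d} \<Longrightarrow> continuous_on K (\<lambda>x. F (x, p))"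
    and "\<And>x p y q. x \<in> K \<Longrightarrow> y \<in> K \<Longrightarrow> p \<in> {1..int d} \<Longrightarrow> q \<in> {1..int d} \<Longrightarrow> p \<le> q \<Longrightarrow>
      view d n (x, p) = view d n (y, q) \<Longrightarrow> F (x, p) = F (y, q)"
  shows "(\<lambda>(x, p). if p - s \<in> {1..int d} then F (x, p - s) else 0) \<in> reach (Suc n)"
proof (rule reach_shift[OF activated_factor[OF view_reach[OF assms(1)] assms(1,3)] assms(1,2)])
  fix z z' assume z: "z \<in> points" "z' \<in> points" "view d n z = view d n z'"
  obtain x p y q where [simp]: "z = (x, p)" "z' = (y, q)" by fastforce
  show "F z = F z'"
    using assms(4)[of x y p q] assms(4)[of y x q p] z by (cases "p \<le> q") auto
qed

text \<open>Equal views at \<open>p < r\<close> would give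
  \<open>n \<le> p < r \<le> d + 1 - n\<close>, against \<open>2 * n > d\<close>. So a view
  determines its position and, at \<open>q'\<close>, also the input; the last layer moves the value
  from \<open>q'\<close> to \<open>q\<close>.\<close>

lemma reach_position:
  assumes n: "n \<ge> 1" "2 * n > d" and q': "q' \<in> {1..int d}" "q' - 1 \<le> int n" "int d - q' \<le> int n"
    and q: "q \<in> {1..int d}" "\<bar>q - q'\<bar> \<le> 1" and Y: "continuous_on UNIV Y"
  shows "(\<lambda>(x, p). if p = q then Y x else 0) \<in> reach (Suc n)"
proof -
  let ?F = "\<lambda>(x, p :: int). if p = q' then Y x else 0"
  have "(\<lambda>(x, p). if p - (q - q') \<in> {1..int d} then ?F (x, p - (q - q')) else 0) \<in> reach (Suc n)"
  proof (rule reach_factor)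
    show "continuous_on K (\<lambda>x. ?F (x, p))" for p
      using Y by (cases "p = q'") (auto intro: continuous_on_subset)
    fix x p y r
    assume *: "x \<in> K" "y \<in> K" "p \<in> {1..int d}" "r \<in> {1..int d}" "p \<le> r" "view d n (x, p) = view d n (y, r)"
    then have "p = r" using view_eq_positions[OF *(6,3,4)] n by force
    then show "?F (x, p) = ?F (y, r)"
      using view_eq_same_position[of d n x p y c] * q' domain_tensors by auto
  qed (use n q in auto)
  then show ?thesis by (rule uspan_cong) (use q' q in auto)
qed

end

text \<open>Truncated translation: positive \<open>s\<close> moves entries towards smaller positions
  and drops those leaving the range.\<close>

definition shift :: "nat \<Rightarrow> int \<Rightarrow> tensor \<Rightarrow> tensor" where
  "shift d s x = (\<lambda>i m. if m \<in> {1..int d} then x i (m + s) else 0)"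

lemma shift_in_tensors: "x \<in> tensors c d \<Longrightarrow> shift d s x \<in> tensors c d"
  by (auto simp: shift_def tensors_def)

lemma continuous_shift: "continuous_on UNIV (shift d s)"
proof (intro continuous_on_coordinatewise_then_product)
  fix i m
  show "continuous_on UNIV (\<lambda>x. shift d s x i m)"
    by (cases "m \<in> {1..int d}") (auto simp: shift_def intro!: continuous_intros)
qed

section \<open>The middle positions for even d, and the cases d = 2 and d = 4\<close>

context cnn_domain
begin

lemma tensors_K: "x \<in> K \<Longrightarrow> x \<in> tensors c d"
  using domain_tensors by blast

text \<open>For \<open>d = 2n\<close> the two middle positions cannot always be told apart: views coincide exactly for
  inputs that are shifts of each other with a zero at the border.\<close>

lemma view_eq_middle:
  assumes d: "d = 2 * n" and K: "x \<in> K" "y \<in> K" and pq: "p \<in> {1..int d}" "q \<in> {1..int d}" "p < q"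
    and eq: "view d n (x, p) = view d n (y, q)"
  shows "p = int n" "q = int n + 1" "x = shift d 1 y" "y = shift d (-1) x"
proof -
  \<comment> \<open>With \<open>d = 2 * n\<close> the bounds read
    \<open>n \<le> p < q \<le> n + 1\<close>.\<close>
  show p: "p = int n" and q: "q = int n + 1"
    using view_eq_positions[OF eq pq] pq d by auto
  have T: "x \<in> tensors c d" "y \<in> tensors c d" using K tensors_K by auto
  show "x = shift d 1 y"
  proof (rule tensors_eqI[OF T(1) shift_in_tensors[OF T(2)]])
    fix i :: nat and m assume im: "i \<ge> 1" "m \<in> {1..int d}"
    then have "x i m = y i (m + (q - p))" using p d by (intro view_eq_entry[OF eq]) auto
    then show "x i m = shift d 1 y i m" using im p q by (simp add: shift_def)
  qed
  show "y = shift d (-1) x"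
  proof (rule tensors_eqI[OF T(2) shift_in_tensors[OF T(1)]])
    fix i :: nat and m assume im: "i \<ge> 1" "m \<in> {1..int d}"
    then have "y i m = x i (m + (p - q))" using q d by (intro view_eq_entry[OF eq[symmetric]]) auto
    then show "y i m = shift d (-1) x i m" using im p q by (simp add: shift_def)
  qed
qed

text \<open>By \<open>view_eq_middle\<close>, a confused pair consists of an input and its shift.
  Prescribing \<open>Y x\<close> at one middle position and \<open>Y\<close> of the shifted input at
  the other is consistent with this, at the price of that second, unwanted term.\<close>

lemma reach_middle:
  assumes d: "d = 2 * n" and Y: "continuous_on UNIV Y" and s: "s \<in> {-1..1}"
  shows "(\<lambda>(x, p). if p - s \<in> {1..int d} then
      if p - s = int n then Y x else if p - s = int n + 1 then Y (shift d 1 x) else 0 else 0) \<in> reach (Suc n)" (is ?left)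
    and "(\<lambda>(x, p). if p - s \<in> {1..int d} then
      if p - s = int n then Y (shift d (-1) x) else if p - s = int n + 1 then Y x else 0 else 0) \<in> reach (Suc n)" (is ?right)
proof -
  have n: "n \<ge> 1" using d positive_dimension by simp
  have Ys: "continuous_on K (\<lambda>x. Y (shift d s x))" "continuous_on K Y" for s
    using continuous_on_compose2[OF Y continuous_shift] Y by (auto intro: continuous_on_subset)
  have same: "x = y" if "view d n (x, p) = view d n (y, p)" "x \<in> K" "y \<in> K" "p = int n \<or> p = int n + 1" for x y p
    using that(4) d
    by (intro view_eq_same_position[OF that(1) tensors_K[OF that(2)] tensors_K[OF that(3)]]) auto
  let ?F = "\<lambda>(x, p :: int). if p = int n then Y x else if p = int n + 1 then Y (shift d 1 x) else 0"
  have "(\<lambda>(x, p). if p - s \<in> {1..int d} then ?F (x, p - s) else 0) \<in> reach (Suc n)"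
  proof (rule reach_factor[OF n s])
    show "continuous_on K (\<lambda>x. ?F (x, p))" for p using Ys by (cases "p = int n"; cases "p = int n + 1") auto
    show "?F (x, p) = ?F (y, q)"
      if "x \<in> K" "y \<in> K" "p \<in> {1..int d}" "q \<in> {1..int d}" "p \<le> q" "view d n (x, p) = view d n (y, q)" for x p y q
    proof (cases "p = q")
      case True
      then show ?thesis using that(6) same[OF _ that(1,2), of p] by auto
    next
      case False
      then have "p < q" using that(5) by simp
      note mid = view_eq_middle[OF d that(1-4) this that(6)]
      show ?thesis using mid(1,2) arg_cong[OF mid(3), of Y] by simp
    qed
  qed
  then show ?left by (simp only: prod.case)
  let ?F = "\<lambda>(x, p :: int). if p = int n then Y (shift d (-1) x) else if p = int n + 1 then Y x else 0"
  have "(\<lambda>(x, p). if p - s \<in> {1..int d} then ?F (x, p - s) else 0) \<in> reach (Suc n)"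
  proof (rule reach_factor[OF n s])
    show "continuous_on K (\<lambda>x. ?F (x, p))" for p using Ys by (cases "p = int n"; cases "p = int n + 1") auto
    show "?F (x, p) = ?F (y, q)"
      if "x \<in> K" "y \<in> K" "p \<in> {1..int d}" "q \<in> {1..int d}" "p \<le> q" "view d n (x, p) = view d n (y, q)" for x p y q
    proof (cases "p = q")
      case True
      then show ?thesis using that(6) same[OF _ that(1,2), of p] by auto
    next
      case False
      then have "p < q" using that(5) by simp
      note mid = view_eq_middle[OF d that(1-4) this that(6)]
      show ?thesis using mid(1,2) arg_cong[OF mid(4), of Y] by simp
    qed
  qed
  then show ?right by (simp only: prod.case)
qed

text \<open>The last layer moves the middle pair by one, and the unwanted term leaves the
  range.\<close>

lemma reach_position_2:
  assumes d: "d = 2" and q: "q \<in> {1..2}" and Y: "continuous_on UNIV Y"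
  shows "(\<lambda>(x, p). if p = q then Y x else 0) \<in> reach 2"
proof -
  have d': "d = 2 * 1" using d by simp
  have R: "reach (Suc 1) = reach 2" by (simp add: numeral_2_eq_2)
  consider "q = 1" | "q = 2" using q by force
  then show ?thesis
  proof cases
    case 1
    show ?thesis
      by (rule uspan_cong[OF reach_middle(2)[OF d' Y, of "-1", unfolded R]]) (auto simp: d 1)
  next
    case 2
    show ?thesis
      by (rule uspan_cong[OF reach_middle(1)[OF d' Y, of 1, unfolded R]]) (auto simp: d 2)
  qed
qed

text \<open>Position 4 sees inputs 2 to 4, all that \<open>shift d 1 x\<close> depends on, and its
  view occurs at no other position; position 1 is symmetric. The last layer moves the value one step
  inwards.\<close>

lemma reach_edge_4:
  assumes d: "d = 4" and Y: "continuous_on UNIV Y"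
  shows "(\<lambda>(x, p). if p = 3 then Y (shift d 1 x) else 0) \<in> reach 3"
    and "(\<lambda>(x, p). if p = 2 then Y (shift d (-1) x) else 0) \<in> reach 3"
proof -
  have Ys: "continuous_on K (\<lambda>x. Y (shift d s x))" for s
    using continuous_on_compose2[OF Y continuous_shift] by (auto intro: continuous_on_subset)
  let ?F = "\<lambda>(x, p :: int). if p = 4 then Y (shift d 1 x) else 0"
  have "(\<lambda>(x, p). if p - (-1) \<in> {1..int d} then ?F (x, p - (-1)) else 0) \<in> reach (Suc 2)"
  proof (rule reach_factor)
    show "continuous_on K (\<lambda>x. ?F (x, p))" for p using Ys by (cases "p = 4") auto
    fix x p y q
    assume *: "x \<in> K" "y \<in> K" "p \<in> {1..int d}" "q \<in> {1..int d}" "p \<le> q" "view d 2 (x, p) = view d 2 (y, q)"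
    have T: "x \<in> tensors c d" "y \<in> tensors c d" using * tensors_K by auto
    have "shift d 1 x = shift d 1 y" if "p = 4" "q = 4"
    proof (rule tensors_eqI[OF shift_in_tensors[OF T(1)] shift_in_tensors[OF T(2)]])
      fix i :: nat and m assume im: "i \<ge> 1" "m \<in> {1..int d}"
      show "shift d 1 x i m = shift d 1 y i m"
      proof (cases "m = 4")
        case True
        then have "shift d 1 x i m = x i 5" "shift d 1 y i m = y i 5" by (auto simp: shift_def d)
        then show ?thesis using T by (auto simp: tensors_def d)
      next
        case False
        then show ?thesis
          using view_eq_entry[OF *(6) im(1), of "m + 1"] im(2) that by (auto simp: shift_def d)
      qed
    qed
    then show "?F (x, p) = ?F (y, q)"
      using view_eq_positions[OF *(6,3,4)] * d by (cases "p = q") auto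
  qed auto
  then show "(\<lambda>(x, p). if p = 3 then Y (shift d 1 x) else 0) \<in> reach 3"
    unfolding numeral_3_eq_3 numeral_2_eq_2 by (rule uspan_cong) (auto simp: d)
  let ?F = "\<lambda>(x, p :: int). if p = 1 then Y (shift d (-1) x) else 0"
  have "(\<lambda>(x, p). if p - 1 \<in> {1..int d} then ?F (x, p - 1) else 0) \<in> reach (Suc 2)"
  proof (rule reach_factor)
    show "continuous_on K (\<lambda>x. ?F (x, p))" for p using Ys by (cases "p = 1") auto
    fix x p y q
    assume *: "x \<in> K" "y \<in> K" "p \<in> {1..int d}" "q \<in> {1..int d}" "p \<le> q" "view d 2 (x, p) = view d 2 (y, q)"
    have T: "x \<in> tensors c d" "y \<in> tensors c d" using * tensors_K by auto
    have "shift d (-1) x = shift d (-1) y" if "p = 1" "q = 1"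
    proof (rule tensors_eqI[OF shift_in_tensors[OF T(1)] shift_in_tensors[OF T(2)]])
      fix i :: nat and m assume im: "i \<ge> 1" "m \<in> {1..int d}"
      show "shift d (-1) x i m = shift d (-1) y i m"
      proof (cases "m = 1")
        case True
        then have "shift d (-1) x i m = x i 0" "shift d (-1) y i m = y i 0" by (auto simp: shift_def d)
        then show ?thesis using T by (auto simp: tensors_def d)
      next
        case False
        then show ?thesis
          using view_eq_entry[OF *(6) im(1), of "m - 1"] im(2) that by (auto simp: shift_def d)
      qed
    qed
    then show "?F (x, p) = ?F (y, q)"
      using view_eq_positions[OF *(6,3,4)] * d by (cases "p = q") auto
  qed auto
  then show "(\<lambda>(x, p). if p = 2 then Y (shift d (-1) x) else 0) \<in> reach 3"
    unfolding numeral_3_eq_3 numeral_2_eq_2 by (rule uspan_cong) (auto simp: d)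
qed

text \<open>Left in place, the middle pair carries the wanted value at \<open>q\<close> and a
  shifted one at the other middle position, which \<open>reach_edge_4\<close> subtracts.\<close>

lemma reach_inner_4:
  assumes d: "d = 4" and Y: "continuous_on UNIV Y" and q: "q = 2 \<or> q = 3"
  shows "(\<lambda>(x, p). if p = q then Y x else 0) \<in> reach 3"
proof -
  have d': "d = 2 * 2" using d by simp
  have R: "reach (Suc 2) = reach 3" by simp
  from q show ?thesis
  proof
    assume "q = 2"
    then show ?thesis
      by (intro uspan_cong[OF uspan_diff[OF reach_middle(1)[OF d' Y, of 0, unfolded R] reach_edge_4(1)[OF d Y]]])
        (auto simp: d)
  next
    assume "q = 3"
    then show ?thesis
      by (intro uspan_cong[OF uspan_diff[OF reach_middle(2)[OF d' Y, of 0, unfolded R] reach_edge_4(2)[OF d Y]]])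
        (auto simp: d)
  qed
qed

text \<open>Moving the middle pair outwards brings the wanted value to a border and leaves a shifted
  term at an inner position, which \<open>reach_inner_4\<close> subtracts.\<close>

lemma reach_position_4:
  assumes d: "d = 4" and q: "q \<in> {1..4}" and Y: "continuous_on UNIV Y"
  shows "(\<lambda>(x, p). if p = q then Y x else 0) \<in> reach 3"
proof -
  have d': "d = 2 * 2" using d by simp
  have R: "reach (Suc 2) = reach 3" by simp
  have Ys: "continuous_on UNIV (\<lambda>x. Y (shift d s x))" for s
    using continuous_on_compose2[OF Y continuous_shift] by auto
  consider "q = 1" | "q = 2 \<or> q = 3" | "q = 4" using q by force
  then show ?thesis
  proof cases
    case 1
    then show ?thesis
      by (intro uspan_cong[OF uspan_diff[OF reach_middle(1)[OF d' Y, of "-1", unfolded R]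
          reach_inner_4[OF d Ys[of 1], of 2]]]) (auto simp: d)
  next
    case 2
    then show ?thesis using reach_inner_4[OF d Y] by blast
  next
    case 3
    then show ?thesis
      by (intro uspan_cong[OF uspan_diff[OF reach_middle(2)[OF d' Y, of 1, unfolded R]
          reach_inner_4[OF d Ys[of "-1"], of 3]]]) (auto simp: d)
  qed
qed

section \<open>Universality at the critical depth\<close>

lemma reach_uap_depth:
  assumes q: "q \<in> {1..int d}" and Y: "continuous_on UNIV Y"
  shows "(\<lambda>(x, p). if p = q then Y x else 0) \<in> reach (uap_depth d)"
proof -
  consider "d = 1" | "d = 2" | "d = 3" | "d = 4" | "d \<ge> 5" using positive_dimension by linarith
  then show ?thesis
  proof cases
    case 1
    then show ?thesis
      using reach_position[of 1 q q Y] q Y by (simp add: uap_depth_def numeral_2_eq_2)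
  next
    case 2
    then show ?thesis using reach_position_2 q Y by (simp add: uap_depth_def)
  next
    case 3
    then show ?thesis
      using reach_position[of 2 q q Y] q Y by (simp add: uap_depth_def numeral_3_eq_3 numeral_2_eq_2)
  next
    case 4
    then show ?thesis using reach_position_4 q Y by (simp add: uap_depth_def)
  next
    case 5
    \<comment> \<open>The nearest position to \<open>q\<close> among \<open>2, ..., d - 1\<close>,
      whose windows of radius \<open>d - 2\<close> cover all inputs. From \<open>d \<ge> 5\<close>
      also \<open>2 * (d - 2) > d\<close>.\<close>
    define q' where "q' = max 2 (min (int d - 1) q)"
    have q': "q' \<in> {1..int d}" "q' - 1 \<le> int (d - 2)" "int d - q' \<le> int (d - 2)" "\<bar>q - q'\<bar> \<le> 1"
      using 5 q by (auto simp: q'_def)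
    have "(\<lambda>(x, p). if p = q then Y x else 0) \<in> reach (Suc (d - 2))"
      using 5 by (intro reach_position[OF _ _ q'(1-3) q q'(4) Y]) auto
    moreover have "uap_depth d = Suc (d - 2)" using 5 by (simp add: uap_depth_def)
    ultimately show ?thesis by simp
  qed
qed

lemma cnns_universal:
  assumes c': "c' \<ge> 1"
    and f: "\<And>i m. continuous_on K (\<lambda>x. f x i m)" and e: "e > 0"
  shows "\<exists>g\<in>cnns \<sigma> d 1 (uap_depth d) c c'.
    \<forall>x\<in>K. \<forall>i\<in>{1..c'}. \<forall>m\<in>{1..int d}. \<bar>f x i m - g x i m\<bar> < e"
proof -
  have "\<exists>h\<in>channels \<sigma> d (uap_depth d) c. \<forall>x\<in>K. \<forall>m\<in>{1..int d}. \<bar>f x i m - h (x, m)\<bar> < e" for i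
  proof -
    \<comment> \<open>Tietze extension: \<open>Y\<close> has to be continuous off \<open>K\<close>
      too, because shifted inputs may lie outside \<open>K\<close>.\<close>
    have "\<exists>Y. continuous_on UNIV Y \<and> (\<forall>x\<in>K. Y x = f x i q)" for q
    proof -
      have "bounded ((\<lambda>x. f x i q) ` K)"
        by (intro compact_imp_bounded compact_continuous_image f compact_domain)
      then obtain M where M: "\<And>x. x \<in> K \<Longrightarrow> \<bar>f x i q\<bar> \<le> M"
        unfolding bounded_iff by (metis imageI real_norm_def)
      have "closedin (top_of_set UNIV) K" "\<And>x. x \<in> K \<Longrightarrow> norm (f x i q) \<le> \<bar>M\<bar>"
        using compact_imp_closed[OF compact_domain] M by force+
      then show ?thesis
        by (rule Tietze[OF f[of i q] _ abs_ge_zero[of M]]) blast+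
    qed
    then obtain Y where Y: "\<And>q. continuous_on UNIV (Y q)" "\<And>q x. x \<in> K \<Longrightarrow> Y q x = f x i q"
      by metis
    \<comment> \<open>The target channel is split into pieces supported at single positions.\<close>
    have "(\<lambda>z. \<Sum>q\<in>{1..int d}. (\<lambda>(x, p). if p = q then Y q x else 0) z) \<in> reach (uap_depth d)"
      by (intro uspan_sum reach_uap_depth Y)
    then have "(\<lambda>(x, m). f x i m) \<in> reach (uap_depth d)"
      by (rule uspan_cong) (auto simp: Y(2))
    moreover have "uap_depth d \<ge> 1" by (auto simp: uap_depth_def)
    ultimately show ?thesis using reach_approx[OF _ _ e] by fastforce
  qed
  then obtain h where h: "\<And>i. h i \<in> channels \<sigma> d (uap_depth d) c"
    "\<And>i x m. x \<in> K \<Longrightarrow> m \<in> {1..int d} \<Longrightarrow> \<bar>f x i m - h i (x, m)\<bar> < e"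
    by metis
  obtain g where "g \<in> cnns \<sigma> d 1 (uap_depth d) c c'" "\<forall>x. \<forall>i\<in>{1..c'}. \<forall>p. g x i p = h i (x, p)"
    using cnns_from_channels[of c' h, OF c' h(1)] by blast
  then show ?thesis using h(2) by (intro bexI[of _ g]) auto
qed

end

theorem theorem1:
  fixes d c c' :: nat and \<sigma> :: "real \<Rightarrow> real"
  assumes "d \<ge> 1" and "c \<ge> 1" and "c' \<ge> 1"
    and "continuous_on UNIV \<sigma>"
    and "\<not> (\<exists>p :: real poly. \<forall>t. \<sigma> t = poly p t)"
  shows "(\<forall>K. compactin (mtopology_of (tensor_metric c d)) K \<longrightarrow>
            cnn_closure \<sigma> d 1 (uap_depth d) c c' K = mspace (C_metric c c' d K)) \<and>
         (\<exists>K. compactin (mtopology_of (tensor_metric c d)) K \<and>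
            \<not> mspace (C_metric c c' d K) \<subseteq> cnn_closure \<sigma> d 1 (uap_depth d - 1) c c' K)"
proof (intro conjI allI impI)
  show "\<exists>K. compactin (mtopology_of (tensor_metric c d)) K \<and>
      \<not> mspace (C_metric c c' d K) \<subseteq> cnn_closure \<sigma> d 1 (uap_depth d - 1) c c' K"
    using depth_lower_bound assms(1-4) by blast
  fix K assume K: "compactin (mtopology_of (tensor_metric c d)) K"
  interpret cnn_domain \<sigma> d c K
    using assms K by unfold_locales (auto simp: compactin_tensor_metric)
  \<comment> \<open>This gives the inclusion of all continuous functions in the closure; the
    converse inclusion is contained in \<open>cnn_closure_iff\<close>.\<close>
  have "\<exists>g\<in>cnns \<sigma> d 1 (uap_depth d) c c'. \<forall>x\<in>K. \<forall>i\<in>{1..c'}. \<forall>m\<in>{1..int d}. \<bar>f x i m - g x i m\<bar> < e"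
    if "f \<in> mspace (C_metric c c' d K)" "e > 0" for f e
  proof (rule cnns_universal[OF assms(3) _ that(2)])
    have "continuous_on K f" using that(1) by (simp add: mspace_C_metric_iff[OF K])
    then show "continuous_on K (\<lambda>x. f x i m)" for i m
      by (rule continuous_on_product_then_coordinatewise[OF continuous_on_product_then_coordinatewise])
  qed
  then show "cnn_closure \<sigma> d 1 (uap_depth d) c c' K = mspace (C_metric c c' d K)"
    using cnn_closure_iff[OF K assms(4)] by blast
qed

end
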